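(* Let $A$ be a strongly ISP-ring such that every nonzero prime ideal of $A$ is maximal. Then $A$ is an almost multiplication ring.
   Context: All rings are commutative with a nonzero unit. An element of a ring is regular if it is not a zero-divisor; an ideal is regular if it contains at least one regular element. A proper ideal $H$ is a radical ideal if $\sqrt H=H$. An ideal $J$ of $A$ is invertible if $JJ'=A$ for some $A$-submodule $J'$ of the total quotient ring $T(A)$; equivalently, $J$ is finitely generated, regular, and $J_M$ is a principal ideal of $A_M$ for each maximal ideal $M$ of $A$ (the ideal $A$ itself is allowed). A ring is a strongly ISP-ring if every proper ideal of it (including the zero ideal) can be written as $JH_1\cdots H_n$ with $J$ an invertible ideal, $n\ge 1$, and all $H_i$ proper radical ideals. A ring $R$ is special primary if $\operatorname{Spec}(R)=\{M\}$ and each proper ideal of $R$ is a power of $M$ (so fields are special primary). A ring $A$ is an almost multiplication ring if for every prime ideal $P$ of $A$ the localization $A_P$ is a discrete rank one valuation domain or a special primary ring. *)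

theory Defs
  imports "HOL-Algebra.Ideal_Product" "HOL-Algebra.Module"
begin

section \<open>Localizations\<close>

text \<open>The fraction \<open>a / s\<close> is represented by its equivalence class: all pairs \<open>(b, t)\<close> with
  \<open>u (a t - b s) = 0\<close> for some \<open>u \<in> S\<close>. The factor \<open>u\<close> is needed because \<open>S\<close> may contain
  zero-divisors.\<close>

definition ring_frac :: "('a, 'm) ring_scheme \<Rightarrow> 'a set \<Rightarrow> 'a \<Rightarrow> 'a \<Rightarrow> ('a \<times> 'a) set" where
  "ring_frac R S a s = {(b, t). b \<in> carrier R \<and> t \<in> S \<and>
     (\<exists>u\<in>S. u \<otimes>\<^bsub>R\<^esub> (a \<otimes>\<^bsub>R\<^esub> t \<ominus>\<^bsub>R\<^esub> b \<otimes>\<^bsub>R\<^esub> s) = \<zero>\<^bsub>R\<^esub>)}"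

text \<open>The localization of \<open>R\<close> at a multiplicative set \<open>S\<close>, as a ring and as an \<open>R\<close>-module. Since the
  operations on fractions do not depend on representatives, the unions below are unions of
  copies of a single class; see \<open>localization_mult\<close> and \<open>localization_add\<close>.\<close>

definition localization ::
  "('a, 'm) ring_scheme \<Rightarrow> 'a set \<Rightarrow> ('a, ('a \<times> 'a) set) module" where
  "localization R S =
    \<lparr> carrier = {ring_frac R S a s | a s. a \<in> carrier R \<and> s \<in> S},
      mult = (\<lambda>x y. \<Union>{ring_frac R S (a \<otimes>\<^bsub>R\<^esub> b) (s \<otimes>\<^bsub>R\<^esub> t) | a s b t. (a, s) \<in> x \<and> (b, t) \<in> y}),
      one = ring_frac R S \<one>\<^bsub>R\<^esub> \<one>\<^bsub>R\<^esub>,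
      zero = ring_frac R S \<zero>\<^bsub>R\<^esub> \<one>\<^bsub>R\<^esub>,
      add = (\<lambda>x y. \<Union>{ring_frac R S (a \<otimes>\<^bsub>R\<^esub> t \<oplus>\<^bsub>R\<^esub> b \<otimes>\<^bsub>R\<^esub> s) (s \<otimes>\<^bsub>R\<^esub> t) | a s b t.
               (a, s) \<in> x \<and> (b, t) \<in> y}),
      smult = (\<lambda>r x. \<Union>{ring_frac R S (r \<otimes>\<^bsub>R\<^esub> a) s | a s. (a, s) \<in> x}) \<rparr>"

context
  fixes R :: "('a, 'm) ring_scheme" (structure) and S
  assumes cring: "cring R" and S: "submonoid S R"
begin

interpretation cring R by (rule cring)

private lemma S_carr [simp]: "s \<in> S \<Longrightarrow> s \<in> carrier R"
  using submonoid.subset[OF S] by blast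

private lemma S_mult [simp]: "s \<in> S \<Longrightarrow> t \<in> S \<Longrightarrow> s \<otimes> t \<in> S"
  by (rule submonoid.m_closed[OF S])

private lemma S_one [simp]: "\<one> \<in> S"
  by (rule submonoid.one_closed[OF S])

private definition eqv where "eqv a s b t \<longleftrightarrow> (\<exists>u\<in>S. u \<otimes> (a \<otimes> t) = u \<otimes> (b \<otimes> s))"

private lemma diff_iff:
  assumes "u \<in> carrier R" "x \<in> carrier R" "y \<in> carrier R"
  shows "u \<otimes> (x \<ominus> y) = \<zero> \<longleftrightarrow> u \<otimes> x = u \<otimes> y"
proof -
  have "u \<otimes> (x \<ominus> y) = u \<otimes> x \<ominus> u \<otimes> y"
    using assms by (simp add: minus_eq r_distr r_minus)
  moreover have "p \<ominus> q = \<zero> \<longleftrightarrow> p = q" if "p \<in> carrier R" "q \<in> carrier R" for p q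
    using that minus_equality[of p "\<ominus> q"] by (auto simp: minus_eq r_neg)
  ultimately show ?thesis using assms by simp
qed

private lemma ring_frac_eqv:
  assumes "a \<in> carrier R" "s \<in> S"
  shows "ring_frac R S a s = {(b, t). b \<in> carrier R \<and> t \<in> S \<and> eqv a s b t}"
  using assms unfolding ring_frac_def eqv_def by (auto simp: diff_iff)

private lemma eqv_refl: "eqv a s a s"
  unfolding eqv_def using S_one by blast

private lemma eqv_sym: "eqv a s b t \<Longrightarrow> eqv b t a s"
  unfolding eqv_def by metis

private lemma eqv_trans:
  assumes "eqv a s b t" "eqv b t c r"
    and c: "a \<in> carrier R" "b \<in> carrier R" "c \<in> carrier R" "s \<in> S" "t \<in> S" "r \<in> S"
  shows "eqv a s c r"
proof -
  obtain u v where u: "u \<in> S" "u \<otimes> (a \<otimes> t) = u \<otimes> (b \<otimes> s)"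
    and v: "v \<in> S" "v \<otimes> (b \<otimes> r) = v \<otimes> (c \<otimes> t)"
    using assms unfolding eqv_def by blast
  have "(u \<otimes> v \<otimes> t) \<otimes> (a \<otimes> r) = (u \<otimes> (a \<otimes> t)) \<otimes> (v \<otimes> r)"
    using u(1) v(1) c by (simp add: m_ac)
  also have "\<dots> = (v \<otimes> (b \<otimes> r)) \<otimes> (u \<otimes> s)"
    unfolding u(2) using u(1) v(1) c by (simp add: m_ac)
  also have "\<dots> = (u \<otimes> v \<otimes> t) \<otimes> (c \<otimes> s)"
    unfolding v(2) using u(1) v(1) c by (simp add: m_ac)
  finally show ?thesis unfolding eqv_def using u(1) v(1) c by (meson S_mult)
qed

private lemma ring_frac_eq_eqv:
  assumes "a \<in> carrier R" "b \<in> carrier R" "s \<in> S" "t \<in> S"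
  shows "ring_frac R S a s = ring_frac R S b t \<longleftrightarrow> eqv a s b t"
proof
  assume "ring_frac R S a s = ring_frac R S b t"
  moreover have "(b, t) \<in> ring_frac R S b t"
    using assms ring_frac_eqv eqv_refl by auto
  ultimately show "eqv a s b t"
    using assms ring_frac_eqv by auto
next
  assume ab: "eqv a s b t"
  have "eqv a s c r \<longleftrightarrow> eqv b t c r" if "c \<in> carrier R" "r \<in> S" for c r
    using eqv_trans[OF ab, of c r] eqv_trans[OF eqv_sym[OF ab], of c r] assms that by blast
  then show "ring_frac R S a s = ring_frac R S b t"
    unfolding ring_frac_eqv[OF assms(1,3)] ring_frac_eqv[OF assms(2,4)]
    by (intro Collect_cong) auto
qed

lemma ring_frac_eq_iff:
  assumes "a \<in> carrier R" "b \<in> carrier R" "s \<in> S" "t \<in> S"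
  shows "ring_frac R S a s = ring_frac R S b t \<longleftrightarrow> (\<exists>u\<in>S. u \<otimes> (a \<otimes> t) = u \<otimes> (b \<otimes> s))"
  using ring_frac_eq_eqv[OF assms] unfolding eqv_def .

private lemma ring_frac_mem:
  assumes "a \<in> carrier R" "s \<in> S" "(b, t) \<in> ring_frac R S a s"
  shows "b \<in> carrier R \<and> t \<in> S \<and> ring_frac R S b t = ring_frac R S a s"
  using assms ring_frac_eqv ring_frac_eq_eqv eqv_sym by auto

private lemma ring_frac_self:
  assumes "a \<in> carrier R" "s \<in> S"
  shows "(a, s) \<in> ring_frac R S a s"
  using assms ring_frac_eqv eqv_refl by auto

lemma localization_mult:
  assumes c: "a \<in> carrier R" "b \<in> carrier R" "s \<in> S" "t \<in> S"
  shows "ring_frac R S a s \<otimes>\<^bsub>localization R S\<^esub> ring_frac R S b t = ring_frac R S (a \<otimes> b) (s \<otimes> t)"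
proof -
  have "ring_frac R S (a' \<otimes> b') (s' \<otimes> t') = ring_frac R S (a \<otimes> b) (s \<otimes> t)"
    if "(a', s') \<in> ring_frac R S a s" "(b', t') \<in> ring_frac R S b t" for a' s' b' t'
  proof -
    have c': "a' \<in> carrier R" "b' \<in> carrier R" "s' \<in> S" "t' \<in> S"
      and "ring_frac R S a' s' = ring_frac R S a s" "ring_frac R S b' t' = ring_frac R S b t"
      using ring_frac_mem that c by blast+
    then obtain u v where u: "u \<in> S" "u \<otimes> (a' \<otimes> s) = u \<otimes> (a \<otimes> s')"
      and v: "v \<in> S" "v \<otimes> (b' \<otimes> t) = v \<otimes> (b \<otimes> t')"
      using c ring_frac_eq_iff by metis
    have "(u \<otimes> v) \<otimes> ((a' \<otimes> b') \<otimes> (s \<otimes> t)) = (u \<otimes> (a' \<otimes> s)) \<otimes> (v \<otimes> (b' \<otimes> t))"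
      using u(1) v(1) c c' by (simp add: m_ac)
    also have "\<dots> = (u \<otimes> v) \<otimes> ((a \<otimes> b) \<otimes> (s' \<otimes> t'))"
      unfolding u(2) v(2) using u(1) v(1) c c' by (simp add: m_ac)
    finally show ?thesis using u(1) v(1) c c' by (subst ring_frac_eq_iff) (auto intro!: bexI[of _ "u \<otimes> v"])
  qed
  then have "{ring_frac R S (a' \<otimes> b') (s' \<otimes> t') | a' s' b' t'.
      (a', s') \<in> ring_frac R S a s \<and> (b', t') \<in> ring_frac R S b t} = {ring_frac R S (a \<otimes> b) (s \<otimes> t)}"
    using ring_frac_self c by blast
  then show ?thesis by (simp add: localization_def)
qed

lemma localization_add:
  assumes c: "a \<in> carrier R" "b \<in> carrier R" "s \<in> S" "t \<in> S"
  shows "ring_frac R S a s \<oplus>\<^bsub>localization R S\<^esub> ring_frac R S b t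
    = ring_frac R S (a \<otimes> t \<oplus> b \<otimes> s) (s \<otimes> t)"
proof -
  have "ring_frac R S (a' \<otimes> t' \<oplus> b' \<otimes> s') (s' \<otimes> t') = ring_frac R S (a \<otimes> t \<oplus> b \<otimes> s) (s \<otimes> t)"
    if "(a', s') \<in> ring_frac R S a s" "(b', t') \<in> ring_frac R S b t" for a' s' b' t'
  proof -
    have c': "a' \<in> carrier R" "b' \<in> carrier R" "s' \<in> S" "t' \<in> S"
      and "ring_frac R S a' s' = ring_frac R S a s" "ring_frac R S b' t' = ring_frac R S b t"
      using ring_frac_mem that c by blast+
    then obtain u v where u: "u \<in> S" "u \<otimes> (a' \<otimes> s) = u \<otimes> (a \<otimes> s')"
      and v: "v \<in> S" "v \<otimes> (b' \<otimes> t) = v \<otimes> (b \<otimes> t')"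
      using c ring_frac_eq_iff by metis
    have "(u \<otimes> v) \<otimes> ((a' \<otimes> t' \<oplus> b' \<otimes> s') \<otimes> (s \<otimes> t))
        = (u \<otimes> (a' \<otimes> s)) \<otimes> (v \<otimes> (t \<otimes> t')) \<oplus> (v \<otimes> (b' \<otimes> t)) \<otimes> (u \<otimes> (s \<otimes> s'))"
      using u(1) v(1) c c' by (simp add: l_distr r_distr m_ac)
    also have "\<dots> = (u \<otimes> v) \<otimes> ((a \<otimes> t \<oplus> b \<otimes> s) \<otimes> (s' \<otimes> t'))"
      unfolding u(2) v(2) using u(1) v(1) c c' by (simp add: l_distr r_distr m_ac)
    finally show ?thesis using u(1) v(1) c c' by (subst ring_frac_eq_iff) (auto intro!: bexI[of _ "u \<otimes> v"])
  qed
  then have "{ring_frac R S (a' \<otimes> t' \<oplus> b' \<otimes> s') (s' \<otimes> t') | a' s' b' t'.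
      (a', s') \<in> ring_frac R S a s \<and> (b', t') \<in> ring_frac R S b t} = {ring_frac R S (a \<otimes> t \<oplus> b \<otimes> s) (s \<otimes> t)}"
    using ring_frac_self c by blast
  then show ?thesis by (simp add: localization_def)
qed

lemma localization_smult:
  assumes c: "r \<in> carrier R" "a \<in> carrier R" "s \<in> S"
  shows "r \<odot>\<^bsub>localization R S\<^esub> ring_frac R S a s = ring_frac R S (r \<otimes> a) s"
proof -
  have "ring_frac R S (r \<otimes> a') s' = ring_frac R S (r \<otimes> a) s" if "(a', s') \<in> ring_frac R S a s" for a' s'
  proof -
    have c': "a' \<in> carrier R" "s' \<in> S" and "ring_frac R S a' s' = ring_frac R S a s"
      using ring_frac_mem that c by blast+
    then obtain u where u: "u \<in> S" "u \<otimes> (a' \<otimes> s) = u \<otimes> (a \<otimes> s')"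
      using c ring_frac_eq_iff by metis
    have "u \<otimes> ((r \<otimes> a') \<otimes> s) = r \<otimes> (u \<otimes> (a' \<otimes> s))"
      using u(1) c c' by (simp add: m_ac)
    also have "\<dots> = u \<otimes> ((r \<otimes> a) \<otimes> s')"
      unfolding u(2) using u(1) c c' by (simp add: m_ac)
    finally show ?thesis using u(1) c c' by (subst ring_frac_eq_iff) auto
  qed
  then have "{ring_frac R S (r \<otimes> a') s' | a' s'. (a', s') \<in> ring_frac R S a s} = {ring_frac R S (r \<otimes> a) s}"
    using ring_frac_self c by blast
  then show ?thesis by (simp add: localization_def)
qed

private lemma loc_simps:
  "carrier (localization R S) = {ring_frac R S a s | a s. a \<in> carrier R \<and> s \<in> S}"
  "\<one>\<^bsub>localization R S\<^esub> = ring_frac R S \<one> \<one>"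
  "\<zero>\<^bsub>localization R S\<^esub> = ring_frac R S \<zero> \<one>"
  by (simp_all add: localization_def)

private lemma ring_frac_eqI:
  assumes "a \<in> carrier R" "b \<in> carrier R" "s \<in> S" "t \<in> S" "a \<otimes> t = b \<otimes> s"
  shows "ring_frac R S a s = ring_frac R S b t"
  using assms ring_frac_eq_iff S_one by metis

private lemma loc_abelian_group: "abelian_group (localization R S)"
proof (rule abelian_groupI)
  fix x y assume "x \<in> carrier (localization R S)" "y \<in> carrier (localization R S)"
  then show "x \<oplus>\<^bsub>localization R S\<^esub> y \<in> carrier (localization R S)"
    and "x \<oplus>\<^bsub>localization R S\<^esub> y = y \<oplus>\<^bsub>localization R S\<^esub> x"
    by (auto simp: loc_simps localization_add m_comm a_comm)
       (metis S_carr S_mult a_closed m_closed)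
next
  fix x y z
  assume "x \<in> carrier (localization R S)" "y \<in> carrier (localization R S)"
    "z \<in> carrier (localization R S)"
  then show "(x \<oplus>\<^bsub>localization R S\<^esub> y) \<oplus>\<^bsub>localization R S\<^esub> z
      = x \<oplus>\<^bsub>localization R S\<^esub> (y \<oplus>\<^bsub>localization R S\<^esub> z)"
    by (auto simp: loc_simps localization_add l_distr r_distr m_ac a_ac)
next
  fix x assume x: "x \<in> carrier (localization R S)"
  then show "\<zero>\<^bsub>localization R S\<^esub> \<oplus>\<^bsub>localization R S\<^esub> x = x"
    by (auto simp: loc_simps localization_add)
  from x obtain a s where a: "x = ring_frac R S a s" "a \<in> carrier R" "s \<in> S"
    by (auto simp: loc_simps)
  have "ring_frac R S (\<ominus> a) s \<oplus>\<^bsub>localization R S\<^esub> x = \<zero>\<^bsub>localization R S\<^esub>"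
    using a by (simp add: loc_simps localization_add flip: l_distr)
       (rule ring_frac_eqI; simp add: l_neg)
  moreover have "ring_frac R S (\<ominus> a) s \<in> carrier (localization R S)"
    using a by (auto simp: loc_simps)
  ultimately show "\<exists>y\<in>carrier (localization R S).
      y \<oplus>\<^bsub>localization R S\<^esub> x = \<zero>\<^bsub>localization R S\<^esub>" by blast
next
  show "\<zero>\<^bsub>localization R S\<^esub> \<in> carrier (localization R S)"
    unfolding loc_simps using S_one zero_closed by blast
qed

lemma localization_cring: "cring (localization R S)"
proof (rule cringI[OF loc_abelian_group])
  show "comm_monoid (localization R S)"
  proof (rule comm_monoidI)
    fix x y assume "x \<in> carrier (localization R S)" "y \<in> carrier (localization R S)"
    then show "x \<otimes>\<^bsub>localization R S\<^esub> y \<in> carrier (localization R S)"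
      and "x \<otimes>\<^bsub>localization R S\<^esub> y = y \<otimes>\<^bsub>localization R S\<^esub> x"
      by (auto simp: loc_simps localization_mult m_comm) (metis S_mult m_closed)
  next
    show "\<one>\<^bsub>localization R S\<^esub> \<in> carrier (localization R S)"
      unfolding loc_simps using S_one one_closed by blast
  qed (auto simp: loc_simps localization_mult m_ac)
next
  fix x y z
  assume "x \<in> carrier (localization R S)" "y \<in> carrier (localization R S)"
    "z \<in> carrier (localization R S)"
  then show "(x \<oplus>\<^bsub>localization R S\<^esub> y) \<otimes>\<^bsub>localization R S\<^esub> z
      = x \<otimes>\<^bsub>localization R S\<^esub> z \<oplus>\<^bsub>localization R S\<^esub> y \<otimes>\<^bsub>localization R S\<^esub> z"
    by (clarsimp simp: loc_simps localization_mult localization_add)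
       (rule ring_frac_eqI; simp add: l_distr r_distr m_ac)
qed

lemma localization_algebra: "algebra R (localization R S)"
proof (rule algebraI[OF cring localization_cring])
  fix r x assume "r \<in> carrier R" "x \<in> carrier (localization R S)"
  then show "r \<odot>\<^bsub>localization R S\<^esub> x \<in> carrier (localization R S)"
    by (auto simp: loc_simps localization_smult) blast
next
  fix a b x assume "a \<in> carrier R" "b \<in> carrier R" "x \<in> carrier (localization R S)"
  then show "(a \<oplus> b) \<odot>\<^bsub>localization R S\<^esub> x
      = (a \<odot>\<^bsub>localization R S\<^esub> x) \<oplus>\<^bsub>localization R S\<^esub> (b \<odot>\<^bsub>localization R S\<^esub> x)"
    by (clarsimp simp: loc_simps localization_smult localization_add)
       (rule ring_frac_eqI; simp add: l_distr r_distr m_ac)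
qed (auto simp: loc_simps localization_smult localization_add localization_mult
        l_distr r_distr m_ac)

end

definition localization_map ::
  "('a, 'm) ring_scheme \<Rightarrow> 'a set \<Rightarrow> 'a \<Rightarrow> ('a \<times> 'a) set" where
  "localization_map R S a = ring_frac R S a \<one>\<^bsub>R\<^esub>"

definition localization_at_prime ::
  "('a, 'm) ring_scheme \<Rightarrow> 'a set \<Rightarrow> ('a, ('a \<times> 'a) set) module" where
  "localization_at_prime R P = localization R (carrier R - P)"

definition regular_elements :: "('a, 'm) ring_scheme \<Rightarrow> 'a set" where
  "regular_elements R =
    {a \<in> carrier R. \<forall>b\<in>carrier R. a \<otimes>\<^bsub>R\<^esub> b = \<zero>\<^bsub>R\<^esub> \<longrightarrow> b = \<zero>\<^bsub>R\<^esub>}"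

lemma submonoid_prime_compl:
  assumes "primeideal P R"
  shows "submonoid (carrier R - P) R"
proof -
  interpret primeideal P R by fact
  show ?thesis
  proof
    show "\<one>\<^bsub>R\<^esub> \<in> carrier R - P"
      using I_notcarr one_imp_carrier by auto
  qed (use I_prime in auto)
qed

lemma submonoid_regular_elements:
  assumes "cring R"
  shows "submonoid (regular_elements R) R"
proof -
  interpret cring R by fact
  show ?thesis
  proof
    fix x y assume "x \<in> regular_elements R" "y \<in> regular_elements R"
    then show "x \<otimes>\<^bsub>R\<^esub> y \<in> regular_elements R"
      unfolding regular_elements_def mem_Collect_eq by (metis m_assoc m_closed)
  qed (simp_all add: regular_elements_def subset_iff)
qed

definition total_quotient_ring ::
  "('a, 'm) ring_scheme \<Rightarrow> ('a, ('a \<times> 'a) set) module" where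
  "total_quotient_ring R = localization R (regular_elements R)"

definition to_total_quotient_ring ::
  "('a, 'm) ring_scheme \<Rightarrow> 'a \<Rightarrow> ('a \<times> 'a) set" where
  "to_total_quotient_ring R = localization_map R (regular_elements R)"


section \<open>Ideals\<close>

definition radical_of :: "('a, 'm) ring_scheme \<Rightarrow> 'a set \<Rightarrow> 'a set" where
  "radical_of R I = {a \<in> carrier R. \<exists>n::nat. n > 0 \<and> a [^]\<^bsub>R\<^esub> n \<in> I}"

definition proper_ideal :: "('a, 'm) ring_scheme \<Rightarrow> 'a set \<Rightarrow> bool" where
  "proper_ideal R I \<longleftrightarrow> ideal I R \<and> I \<noteq> carrier R"

definition proper_radical_ideal :: "('a, 'm) ring_scheme \<Rightarrow> 'a set \<Rightarrow> bool" where
  "proper_radical_ideal R H \<longleftrightarrow> proper_ideal R H \<and> radical_of R H = H"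

text \<open>The condition \<open>J J' = A\<close> is read inside the total quotient ring, in which \<open>A\<close> and its
  ideal \<open>J\<close> are embedded by \<open>to_total_quotient_ring A\<close>. For sets closed under addition and
  negation, \<open>ideal_prod\<close> is the usual product, the set of finite sums of products.\<close>

definition invertible_ideal :: "('a, 'm) ring_scheme \<Rightarrow> 'a set \<Rightarrow> bool" where
  "invertible_ideal A J \<longleftrightarrow> ideal J A \<and>
    (\<exists>J'. submodule J' A (total_quotient_ring A) \<and>
       ideal_prod (total_quotient_ring A) (to_total_quotient_ring A ` J) J'
         = to_total_quotient_ring A ` carrier A)"


section \<open>Classes of rings\<close>

definition strongly_ISP_ring :: "('a, 'm) ring_scheme \<Rightarrow> bool" where
  "strongly_ISP_ring A \<longleftrightarrow>
    (\<forall>I. proper_ideal A I \<longrightarrow>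
      (\<exists>J Hs. invertible_ideal A J \<and> Hs \<noteq> [] \<and>
         (\<forall>H\<in>set Hs. proper_radical_ideal A H) \<and>
         I = foldl (ideal_prod A) J Hs))"

text \<open>In \<open>ideals_set R\<close> multiplication is the product of ideals, so the power is the ideal power.\<close>

definition special_primary_ring :: "('a, 'm) ring_scheme \<Rightarrow> bool" where
  "special_primary_ring R \<longleftrightarrow>
    (\<exists>M. {P. primeideal P R} = {M} \<and>
       (\<forall>I. proper_ideal R I \<longrightarrow> (\<exists>n::nat. I = M [^]\<^bsub>ideals_set R\<^esub> n)))"

text \<open>A discrete rank one valuation domain is the valuation ring, in its quotient field, of a
  valuation with value group \<open>\<int>\<close>. The value \<open>v \<zero> = \<infinity>\<close> is left out: \<open>v\<close> is only constrained on
  nonzero elements.\<close>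

definition discrete_rank_one_valuation_domain :: "('a, 'm) ring_scheme \<Rightarrow> bool" where
  "discrete_rank_one_valuation_domain R \<longleftrightarrow> domain R \<and>
    (let K = total_quotient_ring R; K0 = carrier K - {\<zero>\<^bsub>K\<^esub>} in
     \<exists>v :: ('a \<times> 'a) set \<Rightarrow> int.
       (\<forall>x\<in>K0. \<forall>y\<in>K0. v (x \<otimes>\<^bsub>K\<^esub> y) = v x + v y) \<and>
       (\<forall>x\<in>K0. \<forall>y\<in>K0. x \<oplus>\<^bsub>K\<^esub> y \<noteq> \<zero>\<^bsub>K\<^esub> \<longrightarrow> min (v x) (v y) \<le> v (x \<oplus>\<^bsub>K\<^esub> y)) \<and>
       v ` K0 = UNIV \<and>
       to_total_quotient_ring R ` carrier R = insert \<zero>\<^bsub>K\<^esub> {x \<in> K0. 0 \<le> v x})"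

definition almost_multiplication_ring :: "('a, 'm) ring_scheme \<Rightarrow> bool" where
  "almost_multiplication_ring A \<longleftrightarrow>
    (\<forall>P. primeideal P A \<longrightarrow>
       discrete_rank_one_valuation_domain (localization_at_prime A P) \<or>
       special_primary_ring (localization_at_prime A P))"

end

theory Submission
  imports Defs "HOL-Algebra.Ring_Divisibility"
begin

text \<open>Let \<open>P\<close> be a prime ideal. If \<open>P\<close> is minimal, every element of \<open>P\<close> is nilpotent in \<open>A\<^sub>P\<close>.
  Hence an invertible ideal, which contains a regular element, is not contained in \<open>P\<close>, and a
  radical ideal extends to \<open>A\<^sub>P\<close> or to \<open>P A\<^sub>P\<close>; a factorization of the contraction of an ideal of
  \<open>A\<^sub>P\<close> then writes that ideal as a power of \<open>P A\<^sub>P\<close>.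

  Otherwise \<open>A\<close> is a domain and \<open>P\<close> is maximal. For \<open>0 \<noteq> x \<in> P\<close> the ideal \<open>x A\<^sub>P \<inter> A\<close> has radical
  \<open>P\<close>, so the radical factors in its factorization all equal \<open>P\<close>, and it has the form \<open>K P\<close>. Thus
  \<open>P A\<^sub>P\<close> is a factor of a nonzero principal ideal of a local domain, hence principal. Its
  generator divides every nonzero nonunit and every nonzero element divides some power of it, so
  \<open>A\<^sub>P\<close> is a discrete valuation ring.\<close>

section \<open>Prime ideals, radicals and invertible ideals\<close>

text \<open>Zorn's lemma gives an ideal that is maximal among those containing \<open>I\<close> and
  disjoint from \<open>T\<close>. Such an ideal is prime, because its colon ideals are either itself
  or meet \<open>T\<close>.\<close>

lemma (in cring) exists_primeideal_avoiding:
  assumes I: "ideal I R" and T: "submonoid T R" and IT: "I \<inter> T = {}"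
  obtains Q where "primeideal Q R" "I \<subseteq> Q" "Q \<inter> T = {}"
proof -
  define F where "F = {Q. ideal Q R \<and> I \<subseteq> Q \<and> Q \<inter> T = {}}"
  have "\<exists>Q\<in>F. \<forall>X\<in>F. Q \<subseteq> X \<longrightarrow> X = Q"
  proof (rule subset_Zorn_nonempty)
    show "F \<noteq> {}" using I IT unfolding F_def by blast
  next
    fix C assume C: "C \<noteq> {}" "subset.chain F C"
    then have "subset.chain {I. ideal I R} C"
      unfolding pred_on.chain_def F_def by auto
    then have "ideal (\<Union>C) R"
      using chain_Union_is_ideal[of C] C(1) by simp
    moreover have "I \<subseteq> \<Union>C" "\<Union>C \<inter> T = {}"
      using C unfolding pred_on.chain_def F_def by blast+
    ultimately show "\<Union>C \<in> F" unfolding F_def by blast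
  qed
  then obtain Q where QF: "Q \<in> F" and maxF: "\<forall>X\<in>F. Q \<subseteq> X \<longrightarrow> X = Q"
    by (rule bexE)
  from QF have Q: "ideal Q R" "I \<subseteq> Q" "Q \<inter> T = {}"
    unfolding F_def by simp_all
  have max: "X = Q" if "ideal X R" "Q \<subseteq> X" "X \<inter> T = {}" for X
    using maxF that Q(2) unfolding F_def by simp
  interpret Q: ideal Q R by (rule Q(1))
  have Tc: "T \<subseteq> carrier R" by (rule submonoid.subset[OF T])
  \<comment> \<open>The colon ideal of \<open>Q\<close> by \<open>a\<close> contains
    \<open>Q\<close> and also \<open>b\<close>, which is not in \<open>Q\<close>; by maximality it
    meets \<open>T\<close>.\<close>
  have colon: "\<exists>t\<in>T. a \<otimes> t \<in> Q" if a: "a \<in> carrier R" "b \<in> carrier R" "a \<otimes> b \<in> Q" "b \<notin> Q" for a b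
  proof -
    have "ideal {x \<in> carrier R. a \<otimes> x \<in> Q} R"
      using Q.helper_max_prime is_cring a(1) by blast
    moreover have "Q \<subseteq> {x \<in> carrier R. a \<otimes> x \<in> Q}"
      using Q.I_l_closed Q.Icarr a(1) by blast
    moreover have "{x \<in> carrier R. a \<otimes> x \<in> Q} \<noteq> Q"
      using a by blast
    ultimately show ?thesis using max by blast
  qed
  have "primeideal Q R"
  proof (rule primeidealI[OF Q(1) is_cring])
    show "carrier R \<noteq> Q"
      using Q(3) submonoid.one_closed[OF T] Tc by blast
  next
    fix a b assume ab: "a \<in> carrier R" "b \<in> carrier R" "a \<otimes> b \<in> Q"
    show "a \<in> Q \<or> b \<in> Q"
    proof (rule ccontr)
      assume n: "\<not> (a \<in> Q \<or> b \<in> Q)"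
      then obtain t where t: "t \<in> T" "a \<otimes> t \<in> Q" using colon ab by blast
      then have "t \<otimes> a \<in> Q" using m_comm Tc ab(1) by (metis subsetD)
      \<comment> \<open>The colon argument is applied a second time, now with \<open>t\<close> in
        the place of \<open>a\<close>, and yields a product of two elements of \<open>T\<close>
        inside \<open>Q\<close>.\<close>
      then obtain t' where "t' \<in> T" "t \<otimes> t' \<in> Q" using colon[of t a] n t Tc ab by blast
      then show False using Q(3) submonoid.m_closed[OF T] t(1) by blast
    qed
  qed
  then show ?thesis using that Q by blast
qed

text \<open>Every prime of the localization at \<open>P\<close> that contains \<open>I\<close> is
  the extension of \<open>P\<close> and so contains \<open>y\<close>. Hence \<open>y\<close> is
  nilpotent there modulo \<open>I\<close>, and clearing denominators gives \<open>s\<close> and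
  \<open>n\<close>. Zero \<open>I\<close> serves for minimal primes, principal \<open>I\<close> for
  nonzero primes of a one-dimensional domain.\<close>

lemma (in cring) power_mem_of_isolated_prime:
  assumes I: "ideal I R" and P: "primeideal P R"
    and isolated: "\<And>Q. primeideal Q R \<Longrightarrow> I \<subseteq> Q \<Longrightarrow> Q \<subseteq> P \<Longrightarrow> Q = P"
    and y: "y \<in> P"
  obtains s and n :: nat where "s \<in> carrier R - P" "s \<otimes> y [^] n \<in> I"
proof -
  interpret P: primeideal P R by (rule P)
  note S = submonoid_prime_compl[OF P]
  have yc: "y \<in> carrier R" using y P.Icarr by blast
  \<comment> \<open>An ideal disjoint from \<open>T\<close> lies inside \<open>P\<close> (take
    \<open>n = 0\<close>) and omits \<open>y\<close> (take \<open>n = 1\<close> and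
    \<open>s = \<one>\<close>).\<close>
  define T where "T = {s \<otimes> y [^] n | s (n::nat). s \<in> carrier R - P}"
  have TI: "s \<otimes> y [^] n \<in> T" if "s \<in> carrier R - P" for s and n :: nat
    using that unfolding T_def by blast
  have T: "submonoid T R"
  proof
    show "T \<subseteq> carrier R" using yc unfolding T_def by auto
    show "\<one> \<in> T" using TI[OF submonoid.one_closed[OF S], of 0] by simp
    fix a b assume "a \<in> T" "b \<in> T"
    then obtain s t and m n :: nat where st: "s \<in> carrier R - P" "t \<in> carrier R - P"
      and ab: "a = s \<otimes> y [^] m" "b = t \<otimes> y [^] n" unfolding T_def by blast
    have "a \<otimes> b = (s \<otimes> t) \<otimes> y [^] (m + n)"
      using st yc unfolding ab by (simp add: m_ac flip: nat_pow_mult)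
    then show "a \<otimes> b \<in> T" using TI submonoid.m_closed[OF S st] by simp
  qed
  have "I \<inter> T \<noteq> {}"
  proof
    assume "I \<inter> T = {}"
    then obtain Q where Q: "primeideal Q R" "I \<subseteq> Q" "Q \<inter> T = {}"
      by (rule exists_primeideal_avoiding[OF I T])
    interpret Q: primeideal Q R by (rule Q(1))
    have "Q \<subseteq> P"
    proof (rule subsetI, rule ccontr)
      fix q assume q: "q \<in> Q" "q \<notin> P"
      then have "q \<in> carrier R" using Q.Icarr by simp
      then have "q \<in> T" using q TI[of q 0] by simp
      then show False using q(1) Q(3) by auto
    qed
    then have "Q = P" by (rule isolated[OF Q(1,2)])
    then have "y \<in> Q" using y by simp
    moreover have "y \<in> T" using TI[OF submonoid.one_closed[OF S], of 1] yc by simp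
    ultimately show False using Q(3) by auto
  qed
  then obtain s and n :: nat where "s \<in> carrier R - P" "s \<otimes> y [^] n \<in> I"
    unfolding T_def by auto
  then show ?thesis by (rule that)
qed

text \<open>Every element of \<open>J J'\<close> is a fraction with numerator in \<open>J\<close>; for \<open>\<one>\<close> this numerator is
  regular.\<close>

lemma (in cring) invertible_ideal_regular:
  assumes "invertible_ideal R J"
  obtains r where "r \<in> J" "r \<in> regular_elements R"
proof -
  let ?S = "regular_elements R" and ?K = "total_quotient_ring R"
  note S = submonoid_regular_elements[OF is_cring]
  have Sc: "s \<in> carrier R" if "s \<in> ?S" for s
    using that submonoid.subset[OF S] by blast
  note S1 = submonoid.one_closed[OF S]
  from assms obtain J' where J: "ideal J R" and J': "submodule J' R ?K"
    and prod: "ideal_prod ?K (to_total_quotient_ring R ` J) J' = to_total_quotient_ring R ` carrier R"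
    unfolding invertible_ideal_def by blast
  interpret J: ideal J R by (rule J)
  have num: "\<exists>j\<in>J. \<exists>s\<in>?S. x = ring_frac R ?S j s"
    if "x \<in> ideal_prod ?K (to_total_quotient_ring R ` J) J'" for x
    using that
  proof (induction rule: ideal_prod.induct)
    case (prod i k)
    have "J' \<subseteq> carrier ?K"
      using subgroup.subset[OF submodule.axioms(1)[OF J']] by simp
    then obtain a s where k: "k = ring_frac R ?S a s" "a \<in> carrier R" "s \<in> ?S"
      using prod(2) by (auto simp: total_quotient_ring_def localization_def)
    obtain j where j: "j \<in> J" "i = ring_frac R ?S j \<one>"
      using prod(1) by (auto simp: to_total_quotient_ring_def localization_map_def)
    have "i \<otimes>\<^bsub>?K\<^esub> k = ring_frac R ?S (j \<otimes> a) s"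
      using k j J.Icarr Sc S1 by (simp add: total_quotient_ring_def localization_mult[OF is_cring S])
    moreover have "j \<otimes> a \<in> J" using J.I_r_closed j(1) k(2) by simp
    ultimately show ?case using k(3) by auto
  next
    case (sum x y)
    then obtain j s j' s' where *: "j \<in> J" "s \<in> ?S" "x = ring_frac R ?S j s"
      "j' \<in> J" "s' \<in> ?S" "y = ring_frac R ?S j' s'" by blast
    then have "x \<oplus>\<^bsub>?K\<^esub> y = ring_frac R ?S (j \<otimes> s' \<oplus> j' \<otimes> s) (s \<otimes> s')"
      using J.Icarr by (simp add: total_quotient_ring_def localization_add[OF is_cring S])
    moreover have "j \<otimes> s' \<oplus> j' \<otimes> s \<in> J"
      using * Sc by (simp add: J.I_r_closed J.a_closed)
    moreover have "s \<otimes> s' \<in> ?S" by (rule submonoid.m_closed[OF S *(2,5)])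
    ultimately show ?case by auto
  qed
  have "ring_frac R ?S \<one> \<one> \<in> to_total_quotient_ring R ` carrier R"
    by (auto simp: to_total_quotient_ring_def localization_map_def)
  with num prod obtain j s where j: "j \<in> J" "s \<in> ?S" "ring_frac R ?S \<one> \<one> = ring_frac R ?S j s"
    by metis
  then obtain u where u: "u \<in> ?S" "u \<otimes> (\<one> \<otimes> s) = u \<otimes> (j \<otimes> \<one>)"
    using ring_frac_eq_iff[OF is_cring S one_closed J.Icarr[OF j(1)] S1 j(2)] by auto
  then have "u \<otimes> s \<in> J" using j J.Icarr Sc J.I_l_closed by simp
  moreover have "u \<otimes> s \<in> ?S" by (rule submonoid.m_closed[OF S u(1) j(2)])
  ultimately show ?thesis by (rule that)
qed

text \<open>A regular \<open>r\<close> in \<open>J \<subseteq> P\<close> would be nilpotent in the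
  localization at \<open>P\<close>, so \<open>s \<otimes> r [^] n = \<zero>\<close> with
  \<open>s\<close> outside \<open>P\<close>. Powers of \<open>r\<close> are regular, which forces
  \<open>s = \<zero>\<close>.\<close>

lemma (in cring) invertible_ideal_not_subset_minimal_prime:
  assumes J: "invertible_ideal R J" and P: "primeideal P R"
    and minimal: "\<And>Q. primeideal Q R \<Longrightarrow> Q \<subseteq> P \<Longrightarrow> Q = P"
  shows "\<not> J \<subseteq> P"
proof
  assume "J \<subseteq> P"
  note S = submonoid_regular_elements[OF is_cring]
  interpret P: primeideal P R by (rule P)
  obtain r where r: "r \<in> J" "r \<in> regular_elements R"
    by (rule invertible_ideal_regular[OF J])
  obtain s and n :: nat where s: "s \<in> carrier R - P" "s \<otimes> r [^] n \<in> {\<zero>}"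
    using power_mem_of_isolated_prime[OF zeroideal P minimal] r(1) \<open>J \<subseteq> P\<close> by (metis subsetD)
  have rn: "r [^] n \<in> regular_elements R"
    by (induction n) (simp_all add: submonoid.one_closed[OF S] submonoid.m_closed[OF S _ r(2)])
  then have "r [^] n \<otimes> s = \<zero>"
    using s m_comm[of s "r [^] n"] submonoid.subset[OF S] by (auto dest: subsetD)
  moreover have "\<forall>b\<in>carrier R. r [^] n \<otimes> b = \<zero> \<longrightarrow> b = \<zero>"
    using rn by (simp add: regular_elements_def)
  ultimately have "s = \<zero>" using s(1) by blast
  then show False using s(1) by simp
qed

lemma (in ring) foldl_ideal_prod_is_ideal:
  assumes "ideal J R" "\<And>H. H \<in> set Hs \<Longrightarrow> ideal H R"
  shows "ideal (foldl (ideal_prod R) J Hs) R"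
  using assms by (induction Hs rule: rev_induct) (simp_all add: ideal_prod_is_ideal)

section \<open>Domains with a uniformizer\<close>

text \<open>An elementwise form of a discrete valuation ring, from which the valuation on the
  quotient field can be built by hand.\<close>

locale uniformized_domain = "domain" R for R (structure) +
  fixes t
  assumes t_closed [simp]: "t \<in> carrier R" and t_nonzero: "t \<noteq> \<zero>" and t_nonunit: "t \<notin> Units R"
    and unit_times_power: "a \<in> carrier R \<Longrightarrow> a \<noteq> \<zero> \<Longrightarrow> \<exists>u\<in>Units R. \<exists>n::nat. a = u \<otimes> t [^] n"
begin

lemma t_pow_nonzero: "t [^] (n::nat) \<noteq> \<zero>"
  by (induction n) (simp_all add: integral_iff t_nonzero)

text \<open>Cancelling \<open>t [^] m\<close> leaves \<open>u = v \<otimes> t [^] k\<close>, so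
  \<open>t [^] k\<close> is a unit. As \<open>t\<close> is a nonunit, \<open>k = 0\<close>.\<close>

lemma exponent_unique_le:
  assumes u: "u \<in> Units R" "v \<in> Units R" and eq: "u \<otimes> t [^] m = v \<otimes> t [^] n" and "m \<le> n"
  shows "m = (n::nat)"
proof -
  obtain k where k: "n = m + k" using \<open>m \<le> n\<close> le_Suc_ex by auto
  note uc = Units_closed[OF u(1)] Units_closed[OF u(2)]
  have "t [^] m \<otimes> u = t [^] m \<otimes> (v \<otimes> t [^] k)"
    using eq uc by (simp add: k m_ac flip: nat_pow_mult)
  then have "u = v \<otimes> t [^] k"
    using m_lcancel[OF t_pow_nonzero] uc by simp
  then have "t [^] k \<otimes> v \<in> Units R" using u(1) uc m_comm[of "t [^] k" v] by simp
  then have "t [^] k \<in> Units R" by (rule unit_factor) (simp_all add: uc)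
  moreover have "t [^] k \<notin> Units R" if "k = Suc j" for j
    using unit_factor[of t "t [^] j"] t_nonunit m_comm[of t "t [^] j"] unfolding that by auto
  ultimately show ?thesis using k by (cases k) auto
qed

lemma exponent_unique:
  assumes "u \<in> Units R" "v \<in> Units R" "u \<otimes> t [^] m = v \<otimes> t [^] (n::nat)"
  shows "m = n"
  using exponent_unique_le[OF assms] exponent_unique_le[OF assms(2,1) assms(3)[symmetric]]
  by linarith

text \<open>For nonzero elements the exponent exists and is unique. At zero no exponent exists and
  the value is unspecified, which is why the facts about \<open>ord\<close> speak of nonzero
  elements.\<close>

definition ord :: "'a \<Rightarrow> nat" where
  "ord a = (THE n. \<exists>u\<in>Units R. a = u \<otimes> t [^] n)"

lemma ord_eq:
  assumes u: "u \<in> Units R"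
  shows "ord (u \<otimes> t [^] n) = n"
  unfolding ord_def
proof (rule the_equality)
  show "\<exists>v\<in>Units R. u \<otimes> t [^] n = v \<otimes> t [^] n" by (rule bexI[OF _ u]) (rule refl)
  show "m = n" if m: "\<exists>v\<in>Units R. u \<otimes> t [^] n = v \<otimes> t [^] m" for m
  proof -
    obtain v where "v \<in> Units R" "u \<otimes> t [^] n = v \<otimes> t [^] m" using m by (rule bexE)
    then show ?thesis using exponent_unique[of v u m n] u by simp
  qed
qed

lemma ord_decomposition:
  assumes "a \<in> carrier R" "a \<noteq> \<zero>"
  obtains u where "u \<in> Units R" "a = u \<otimes> t [^] ord a"
proof -
  obtain u n where u: "u \<in> Units R" "a = u \<otimes> t [^] (n::nat)"
    using unit_times_power[OF assms] by (elim bexE exE)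
  then show ?thesis using that[OF u(1)] ord_eq[OF u(1), of n] by simp
qed

lemma ord_mult:
  assumes a: "a \<in> carrier R" "a \<noteq> \<zero>" and b: "b \<in> carrier R" "b \<noteq> \<zero>"
  shows "ord (a \<otimes> b) = ord a + ord b"
proof -
  obtain u where u: "u \<in> Units R" "a = u \<otimes> t [^] ord a" using a by (rule ord_decomposition)
  obtain v where v: "v \<in> Units R" "b = v \<otimes> t [^] ord b" using b by (rule ord_decomposition)
  have "a \<otimes> b = (u \<otimes> t [^] ord a) \<otimes> (v \<otimes> t [^] ord b)"
    using u(2) v(2) by simp
  also have "\<dots> = (u \<otimes> v) \<otimes> t [^] (ord a + ord b)"
    using Units_closed[OF u(1)] Units_closed[OF v(1)] by (simp add: m_ac flip: nat_pow_mult)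
  finally show ?thesis using ord_eq Units_m_closed[OF u(1) v(1)] by simp
qed

text \<open>The quotient is a unit times \<open>t [^] (ord b - ord a)\<close>. This serves both the
  inequality for sums and the recovery of \<open>R\<close> as the valuation ring.\<close>

lemma ord_le_divides:
  assumes a: "a \<in> carrier R" "a \<noteq> \<zero>" and b: "b \<in> carrier R" "b \<noteq> \<zero>" and le: "ord a \<le> ord b"
  obtains c where "c \<in> carrier R" "b = a \<otimes> c"
proof -
  obtain u where u: "u \<in> Units R" "a = u \<otimes> t [^] ord a" using a by (rule ord_decomposition)
  obtain v where v: "v \<in> Units R" "b = v \<otimes> t [^] ord b" using b by (rule ord_decomposition)
  note c = Units_closed[OF u(1)] Units_closed[OF v(1)] Units_inv_closed[OF u(1)]
  let ?c = "inv u \<otimes> v \<otimes> t [^] (ord b - ord a)"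
  have "a \<otimes> ?c = (u \<otimes> t [^] ord a) \<otimes> ?c" using u(2) by simp
  also have "\<dots> = (u \<otimes> inv u) \<otimes> (v \<otimes> (t [^] ord a \<otimes> t [^] (ord b - ord a)))"
    using c by (simp add: m_ac)
  also have "\<dots> = v \<otimes> t [^] ord b"
    using c u(1) le by (simp add: nat_pow_mult)
  finally have "b = a \<otimes> ?c" using v(2) by simp
  moreover have "?c \<in> carrier R" using c by simp
  ultimately show ?thesis using that by blast
qed

text \<open>By symmetry \<open>ord a \<le> ord b\<close>. Then \<open>a\<close> divides
  \<open>b\<close> and hence \<open>a \<oplus> b\<close>, and \<open>ord\<close> is additive on
  products.\<close>

lemma ord_add:
  assumes a: "a \<in> carrier R" "a \<noteq> \<zero>" and b: "b \<in> carrier R" "b \<noteq> \<zero>" and ab: "a \<oplus> b \<noteq> \<zero>"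
  shows "min (ord a) (ord b) \<le> ord (a \<oplus> b)"
proof -
  have *: "ord a \<le> ord (a \<oplus> b)"
    if a: "a \<in> carrier R" "a \<noteq> \<zero>" and b: "b \<in> carrier R" "b \<noteq> \<zero>"
      and ab: "a \<oplus> b \<noteq> \<zero>" and le: "ord a \<le> ord b" for a b
  proof -
    obtain c where c: "c \<in> carrier R" "b = a \<otimes> c"
      using a b le by (rule ord_le_divides)
    then have sum: "a \<oplus> b = a \<otimes> (\<one> \<oplus> c)" using a by (simp add: r_distr)
    then have "\<one> \<oplus> c \<noteq> \<zero>" using ab a by auto
    then show ?thesis using sum ord_mult[OF a, of "\<one> \<oplus> c"] c by simp
  qed
  show ?thesis
  proof (cases "ord a \<le> ord b")
    case True
    then show ?thesis using *[OF a b ab] by simp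
  next
    case False
    then show ?thesis using *[OF b a] ab a_comm[OF a(1) b(1)] by simp
  qed
qed

section \<open>The quotient field and its valuation\<close>

lemma regular_elements_iff: "a \<in> regular_elements R \<longleftrightarrow> a \<in> carrier R \<and> a \<noteq> \<zero>"
  unfolding regular_elements_def using integral_iff by (auto dest: bspec[OF _ one_closed])

abbreviation "K \<equiv> total_quotient_ring R"
abbreviation "fraction \<equiv> ring_frac R (regular_elements R)"

lemmas K_mult = localization_mult[OF is_cring submonoid_regular_elements[OF is_cring],
    folded total_quotient_ring_def, unfolded regular_elements_iff]

lemmas K_add = localization_add[OF is_cring submonoid_regular_elements[OF is_cring],
    folded total_quotient_ring_def, unfolded regular_elements_iff]

lemma fraction_eq_iff:
  assumes "a \<in> carrier R" "b \<in> carrier R" "r \<in> carrier R" "r \<noteq> \<zero>" "s \<in> carrier R" "s \<noteq> \<zero>"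
  shows "fraction a r = fraction b s \<longleftrightarrow> a \<otimes> s = b \<otimes> r"
proof -
  have "fraction a r = fraction b s \<longleftrightarrow> (\<exists>u\<in>regular_elements R. u \<otimes> (a \<otimes> s) = u \<otimes> (b \<otimes> r))"
    using assms
    by (intro ring_frac_eq_iff[OF is_cring submonoid_regular_elements[OF is_cring]])
       (simp_all add: regular_elements_iff)
  also have "\<dots> \<longleftrightarrow> (\<exists>u\<in>regular_elements R. a \<otimes> s = b \<otimes> r)"
    using assms by (intro bex_cong refl) (simp add: regular_elements_iff m_lcancel)
  also have "\<dots> \<longleftrightarrow> a \<otimes> s = b \<otimes> r"
    using submonoid.one_closed[OF submonoid_regular_elements[OF is_cring]] by auto
  finally show ?thesis .
qed

lemma K_zero: "\<zero>\<^bsub>K\<^esub> = fraction \<zero> \<one>"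
  by (simp add: total_quotient_ring_def localization_def)

lemma fraction_eq_zero_iff:
  assumes "a \<in> carrier R" "s \<in> carrier R" "s \<noteq> \<zero>"
  shows "fraction a s = \<zero>\<^bsub>K\<^esub> \<longleftrightarrow> a = \<zero>"
  using assms unfolding K_zero by (subst fraction_eq_iff) simp_all

lemma fraction_in_K0:
  assumes "a \<in> carrier R" "a \<noteq> \<zero>" "s \<in> carrier R" "s \<noteq> \<zero>"
  shows "fraction a s \<in> carrier K - {\<zero>\<^bsub>K\<^esub>}"
proof -
  have "fraction a s \<in> carrier K"
    using assms by (auto simp: total_quotient_ring_def localization_def regular_elements_iff)
  then show ?thesis using assms fraction_eq_zero_iff by simp
qed

lemma K0_cases:
  assumes "x \<in> carrier K - {\<zero>\<^bsub>K\<^esub>}"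
  obtains a s where "x = fraction a s" "a \<in> carrier R" "a \<noteq> \<zero>" "s \<in> carrier R" "s \<noteq> \<zero>"
proof -
  obtain a s where x: "x = fraction a s" "a \<in> carrier R" "s \<in> carrier R" "s \<noteq> \<zero>"
    using assms by (auto simp: total_quotient_ring_def localization_def regular_elements_iff)
  then have "a \<noteq> \<zero>" using assms fraction_eq_zero_iff by auto
  with x show ?thesis using that by simp
qed

definition val :: "('a \<times> 'a) set \<Rightarrow> int" where
  "val x = (THE k. \<exists>a s. a \<in> carrier R \<and> a \<noteq> \<zero> \<and> s \<in> carrier R \<and> s \<noteq> \<zero> \<and>
     x = fraction a s \<and> k = int (ord a) - int (ord s))"

text \<open>Equal fractions satisfy \<open>a \<otimes> r = b \<otimes> s\<close>, so additivity of
  \<open>ord\<close> makes the difference independent of the representative.\<close>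

lemma val_fraction:
  assumes "a \<in> carrier R" "a \<noteq> \<zero>" "s \<in> carrier R" "s \<noteq> \<zero>"
  shows "val (fraction a s) = int (ord a) - int (ord s)"
  unfolding val_def
proof (rule the_equality)
  fix k
  assume "\<exists>b r. b \<in> carrier R \<and> b \<noteq> \<zero> \<and> r \<in> carrier R \<and> r \<noteq> \<zero> \<and>
     fraction a s = fraction b r \<and> k = int (ord b) - int (ord r)"
  then obtain b r where b: "b \<in> carrier R" "b \<noteq> \<zero>" "r \<in> carrier R" "r \<noteq> \<zero>"
    "fraction a s = fraction b r" and k: "k = int (ord b) - int (ord r)" by (elim exE conjE)
  have "a \<otimes> r = b \<otimes> s" using b assms fraction_eq_iff[of a b s r] by simp
  then have "ord a + ord r = ord b + ord s"
    using ord_mult[of a r] ord_mult[of b s] b assms by simp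
  then show "k = int (ord a) - int (ord s)" using k by linarith
qed (use assms in auto)

text \<open>Products and sums reduce to \<open>ord\<close> of numerators over a common denominator.
  A fraction of nonnegative value has a denominator that divides its numerator, so the valuation
  ring is exactly the image of \<open>R\<close>.\<close>

theorem discrete_rank_one_valuation: "discrete_rank_one_valuation_domain R"
proof -
  let ?K0 = "carrier K - {\<zero>\<^bsub>K\<^esub>}"
  have mult: "val (x \<otimes>\<^bsub>K\<^esub> y) = val x + val y" if x: "x \<in> ?K0" and y: "y \<in> ?K0" for x y
  proof -
    obtain a s where a: "x = fraction a s" "a \<in> carrier R" "a \<noteq> \<zero>" "s \<in> carrier R" "s \<noteq> \<zero>"
      using x by (rule K0_cases)
    obtain b r where b: "y = fraction b r" "b \<in> carrier R" "b \<noteq> \<zero>" "r \<in> carrier R" "r \<noteq> \<zero>"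
      using y by (rule K0_cases)
    show ?thesis using a b by (simp add: K_mult val_fraction ord_mult integral_iff)
  qed
  have add: "min (val x) (val y) \<le> val (x \<oplus>\<^bsub>K\<^esub> y)"
    if x: "x \<in> ?K0" and y: "y \<in> ?K0" and xy: "x \<oplus>\<^bsub>K\<^esub> y \<noteq> \<zero>\<^bsub>K\<^esub>" for x y
  proof -
    obtain a s where a: "x = fraction a s" "a \<in> carrier R" "a \<noteq> \<zero>" "s \<in> carrier R" "s \<noteq> \<zero>"
      using x by (rule K0_cases)
    obtain b r where b: "y = fraction b r" "b \<in> carrier R" "b \<noteq> \<zero>" "r \<in> carrier R" "r \<noteq> \<zero>"
      using y by (rule K0_cases)
    have sum: "x \<oplus>\<^bsub>K\<^esub> y = fraction (a \<otimes> r \<oplus> b \<otimes> s) (s \<otimes> r)" using a b by (simp add: K_add)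
    have nz: "a \<otimes> r \<oplus> b \<otimes> s \<noteq> \<zero>"
      using xy a b fraction_eq_zero_iff unfolding sum by (simp add: integral_iff)
    have "min (ord a + ord r) (ord b + ord s) \<le> ord (a \<otimes> r \<oplus> b \<otimes> s)"
      using ord_add[OF _ _ _ _ nz] a b by (simp add: integral_iff ord_mult)
    then show ?thesis
      unfolding sum using a b nz by (simp add: val_fraction integral_iff ord_mult)
  qed
  have ord_pow: "ord (t [^] n) = n" for n :: nat
    using ord_eq[OF Units_one_closed, of n] by simp
  have ord_one: "ord \<one> = 0" using ord_pow[of 0] by simp
  have "k \<in> val ` ?K0" for k
  proof (rule image_eqI)
    \<comment> \<open>Since \<open>nat\<close> sends negative integers to zero, at most one of the
      two exponents is nonzero: the fraction is the \<open>k\<close>-th power of \<open>t\<close>,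
      also for negative \<open>k\<close>.\<close>
    show "k = val (fraction (t [^] nat k) (t [^] nat (- k)))"
      by (simp add: val_fraction t_pow_nonzero ord_pow)
    show "fraction (t [^] nat k) (t [^] nat (- k)) \<in> ?K0"
      by (rule fraction_in_K0) (simp_all add: t_pow_nonzero)
  qed
  then have surj: "val ` ?K0 = UNIV" by auto
  have ring: "to_total_quotient_ring R ` carrier R = insert \<zero>\<^bsub>K\<^esub> {x \<in> ?K0. 0 \<le> val x}"
  proof (rule antisym; rule subsetI)
    fix x assume "x \<in> to_total_quotient_ring R ` carrier R"
    then obtain a where x: "x = fraction a \<one>" "a \<in> carrier R"
      by (auto simp: to_total_quotient_ring_def localization_map_def)
    show "x \<in> insert \<zero>\<^bsub>K\<^esub> {x \<in> ?K0. 0 \<le> val x}"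
    proof (cases "a = \<zero>")
      case True
      then show ?thesis using x K_zero by simp
    next
      case False
      then show ?thesis using x fraction_in_K0[of a \<one>] by (simp add: val_fraction ord_one)
    qed
  next
    fix x assume x: "x \<in> insert \<zero>\<^bsub>K\<^esub> {x \<in> ?K0. 0 \<le> val x}"
    have "\<exists>c\<in>carrier R. x = fraction c \<one>"
    proof (cases "x = \<zero>\<^bsub>K\<^esub>")
      case True
      then show ?thesis using K_zero by auto
    next
      case False
      then have x0: "x \<in> ?K0" and le: "0 \<le> val x" using x by auto
      obtain a s where a: "x = fraction a s" "a \<in> carrier R" "a \<noteq> \<zero>" "s \<in> carrier R" "s \<noteq> \<zero>"
        using x0 by (rule K0_cases)
      then have "ord s \<le> ord a" using le by (simp add: val_fraction)
      then obtain c where c: "c \<in> carrier R" "a = s \<otimes> c"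
        by (rule ord_le_divides[OF a(4,5,2,3)])
      then have "x = fraction c \<one>"
        using a fraction_eq_iff[of a c s \<one>] m_comm by simp
      then show ?thesis using c by auto
    qed
    then show "x \<in> to_total_quotient_ring R ` carrier R"
      by (auto simp: to_total_quotient_ring_def localization_map_def)
  qed
  show ?thesis
    unfolding discrete_rank_one_valuation_domain_def Let_def
    using mult add surj ring domain_axioms by (intro conjI exI[of _ val] ballI impI) auto
qed

end

section \<open>Localization at a prime ideal\<close>

locale prime_localization = primeideal P R for P and R (structure)
begin

definition S :: "'a set" where
  "S = carrier R - P"

abbreviation "B \<equiv> localization_at_prime R P"
abbreviation "fraction \<equiv> ring_frac R S"

text \<open>For an ideal \<open>K\<close> this is the ideal generated by the image of
  \<open>K\<close>; a common denominator turns any finite sum into a single fraction, so no sums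
  appear.\<close>

definition extension :: "'a set \<Rightarrow> ('a \<times> 'a) set set" where
  "extension K = {fraction a s | a s. a \<in> K \<and> s \<in> S}"

lemma submonoid_S: "submonoid S R"
  unfolding S_def by (rule submonoid_prime_compl[OF primeideal])

lemma S_one [simp]: "\<one> \<in> S" and S_mult [simp]: "s \<in> S \<Longrightarrow> t \<in> S \<Longrightarrow> s \<otimes> t \<in> S"
  by (rule submonoid.one_closed[OF submonoid_S], rule submonoid.m_closed[OF submonoid_S])

lemma S_closed [simp]: "s \<in> S \<Longrightarrow> s \<in> carrier R"
  by (simp add: S_def)

lemma B_def: "B = localization R S"
  by (simp add: localization_at_prime_def S_def)

lemma B_cring: "cring B"
  unfolding B_def by (rule localization_cring[OF is_cring submonoid_S])

interpretation B: cring B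
  by (rule B_cring)

lemma B_carrier: "carrier B = {fraction a s | a s. a \<in> carrier R \<and> s \<in> S}"
  and B_one: "\<one>\<^bsub>B\<^esub> = fraction \<one> \<one>" and B_zero: "\<zero>\<^bsub>B\<^esub> = fraction \<zero> \<one>"
  by (simp_all add: B_def localization_def)

lemma fraction_closed [simp]: "a \<in> carrier R \<Longrightarrow> s \<in> S \<Longrightarrow> fraction a s \<in> carrier B"
  unfolding B_carrier by auto

lemma B_carrierE:
  assumes "x \<in> carrier B"
  obtains a s where "x = fraction a s" "a \<in> carrier R" "s \<in> S"
  using assms unfolding B_carrier by (elim CollectE exE conjE) (rule that)

lemma extensionI: "a \<in> K \<Longrightarrow> s \<in> S \<Longrightarrow> fraction a s \<in> extension K"
  unfolding extension_def by (intro CollectI exI conjI) (rule refl)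

lemma extensionE:
  assumes "x \<in> extension K"
  obtains a s where "x = fraction a s" "a \<in> K" "s \<in> S"
  using assms unfolding extension_def by (elim CollectE exE conjE) (rule that)

lemmas fraction_mult = localization_mult[OF is_cring submonoid_S, folded B_def]
lemmas fraction_add = localization_add[OF is_cring submonoid_S, folded B_def]
lemmas fraction_eq_iff = ring_frac_eq_iff[OF is_cring submonoid_S]

lemma fraction_eqI:
  assumes "a \<in> carrier R" "b \<in> carrier R" "s \<in> S" "t \<in> S" "a \<otimes> t = b \<otimes> s"
  shows "fraction a s = fraction b t"
  using fraction_eq_iff[OF assms(1-4)] assms(5) S_one by metis

lemma localization_map_hom: "ring_hom_ring R B (\<lambda>a. fraction a \<one>)"
proof (rule ring_hom_ringI)
  show "ring R" "ring B" by (rule ring_axioms B.ring_axioms)+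
qed (simp_all add: fraction_mult fraction_add B_one)

lemma fraction_unit:
  assumes "a \<in> S" "s \<in> S"
  shows "fraction a s \<in> Units B"
proof -
  have "fraction a s \<otimes>\<^bsub>B\<^esub> fraction s a = \<one>\<^bsub>B\<^esub>"
    using assms by (simp add: fraction_mult B_one) (rule fraction_eqI; simp add: m_ac)
  then show ?thesis
    using assms B.m_comm[of "fraction a s" "fraction s a"] unfolding Units_def
    by (intro CollectI conjI bexI[of _ "fraction s a"]) simp_all
qed

section \<open>Extension of ideals to the localization\<close>

lemma fraction_mem_extension_iff:
  assumes K: "ideal K R" and a: "a \<in> carrier R" "s \<in> S"
  shows "fraction a s \<in> extension K \<longleftrightarrow> (\<exists>u\<in>S. u \<otimes> a \<in> K)"
proof
  interpret K: ideal K R by (rule K)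
  show "\<exists>u\<in>S. u \<otimes> a \<in> K" if asm: "fraction a s \<in> extension K"
  proof -
    obtain k t where k: "fraction a s = fraction k t" "k \<in> K" "t \<in> S"
      using asm by (rule extensionE)
    then obtain u where u: "u \<in> S" "u \<otimes> (a \<otimes> t) = u \<otimes> (k \<otimes> s)"
      using fraction_eq_iff[of a k s t] a K.Icarr[OF k(2)] k by auto
    \<comment> \<open>The multiplier that moves \<open>a\<close> into \<open>K\<close> is
      \<open>u \<otimes> t\<close>: it clears the other denominator and absorbs the factor in the
      equality of fractions.\<close>
    have "(u \<otimes> t) \<otimes> a = u \<otimes> (k \<otimes> s)" using u a k by (simp add: m_ac)
    also have "\<dots> \<in> K" using K.I_l_closed K.I_r_closed k a u by simp
    finally show ?thesis using S_mult[OF u(1) k(3)] by auto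
  qed
  show "fraction a s \<in> extension K" if asm: "\<exists>u\<in>S. u \<otimes> a \<in> K"
  proof -
    obtain u where u: "u \<in> S" "u \<otimes> a \<in> K" using asm by (rule bexE)
    then have "fraction a s = fraction (u \<otimes> a) (u \<otimes> s)"
      using a by (intro fraction_eqI) (simp_all add: m_ac)
    then show ?thesis using extensionI[OF u(2) S_mult[OF u(1) a(2)]] by simp
  qed
qed

lemma extension_ideal:
  assumes K: "ideal K R"
  shows "ideal (extension K) B"
proof (rule idealI[OF B.ring_axioms])
  interpret K: ideal K R by (rule K)
  have sub: "extension K \<subseteq> carrier B"
    by (auto elim!: extensionE dest: K.Icarr)
  have l_closed: "x \<otimes>\<^bsub>B\<^esub> a \<in> extension K" if asm: "a \<in> extension K" "x \<in> carrier B" for a x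
  proof -
    obtain k s r t where *: "a = fraction k s" "k \<in> K" "s \<in> S" "x = fraction r t" "r \<in> carrier R" "t \<in> S"
      by (meson asm B_carrierE extensionE)
    then have "x \<otimes>\<^bsub>B\<^esub> a = fraction (r \<otimes> k) (t \<otimes> s)"
      by (simp add: fraction_mult K.Icarr)
    moreover have "r \<otimes> k \<in> K" using * K.I_l_closed by simp
    ultimately show ?thesis
      using extensionI S_mult[OF *(6,3)] by simp
  qed
  then show "x \<otimes>\<^bsub>B\<^esub> a \<in> extension K" "a \<otimes>\<^bsub>B\<^esub> x \<in> extension K"
    if "a \<in> extension K" "x \<in> carrier B" for a x
    using l_closed[OF that] B.m_comm[of a x] subsetD[OF sub that(1)] that(2) by simp_all
  show "subgroup (extension K) (add_monoid B)"
  proof (rule B.add.subgroupI)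
    show "extension K \<subseteq> carrier B" by (rule sub)
    show "extension K \<noteq> {}" using extensionI[OF K.zero_closed S_one] by auto
    fix x assume x: "x \<in> extension K"
    then have "(\<ominus>\<^bsub>B\<^esub> \<one>\<^bsub>B\<^esub>) \<otimes>\<^bsub>B\<^esub> x \<in> extension K" using l_closed by simp
    then show "\<ominus>\<^bsub>B\<^esub> x \<in> extension K" using B.l_minus[of "\<one>\<^bsub>B\<^esub>" x] subsetD[OF sub x] by simp
    fix y assume "y \<in> extension K"
    with x obtain k s l t where *: "x = fraction k s" "k \<in> K" "s \<in> S" "y = fraction l t" "l \<in> K" "t \<in> S"
      by (meson extensionE)
    then have "x \<oplus>\<^bsub>B\<^esub> y = fraction (k \<otimes> t \<oplus> l \<otimes> s) (s \<otimes> t)"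
      by (simp add: fraction_add K.Icarr)
    moreover have "k \<otimes> t \<oplus> l \<otimes> s \<in> K" using * K.I_r_closed K.a_closed by simp
    ultimately show "x \<oplus>\<^bsub>B\<^esub> y \<in> extension K"
      using extensionI S_mult[OF *(3,6)] by simp
  qed
qed

text \<open>Denominators can be pushed into one factor, as in
  \<open>k l / s = (k / s) (l / 1)\<close>, and collected again from both. This carries
  factorizations from \<open>R\<close> over to \<open>B\<close>.\<close>

lemma extension_ideal_prod:
  assumes K: "ideal K R" and L: "ideal L R"
  shows "extension (ideal_prod R K L) = ideal_prod B (extension K) (extension L)"
proof (rule antisym; rule subsetI)
  interpret K: ideal K R by (rule K)
  interpret L: ideal L R by (rule L)
  have KLc: "z \<in> carrier R" if "z \<in> ideal_prod R K L" for z
    using that ideal_prod_in_carrier[OF K L] by auto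
  show "x \<in> ideal_prod B (extension K) (extension L)" if asm: "x \<in> extension (ideal_prod R K L)" for x
  proof -
    obtain z s where "x = fraction z s" "z \<in> ideal_prod R K L" and s: "s \<in> S"
      using asm by (rule extensionE)
    moreover have "fraction z s \<in> ideal_prod B (extension K) (extension L)" if "z \<in> ideal_prod R K L"
      using that
    proof (induction rule: ideal_prod.induct)
      case (prod k l)
      have "fraction (k \<otimes> l) s = fraction k s \<otimes>\<^bsub>B\<^esub> fraction l \<one>"
        using prod s K.Icarr L.Icarr by (simp add: fraction_mult)
      moreover have "fraction k s \<in> extension K" "fraction l \<one> \<in> extension L"
        using prod s extensionI S_one by simp_all
      ultimately show ?case by (simp add: ideal_prod.prod)
    next
      case (sum y z)
      have "fraction (y \<oplus> z) s = fraction y s \<oplus>\<^bsub>B\<^esub> fraction z s"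
        using sum s KLc by (simp add: fraction_add) (rule fraction_eqI; simp add: l_distr r_distr m_ac)
      then show ?case using sum by (simp add: ideal_prod.sum)
    qed
    ultimately show ?thesis by simp
  qed
  show "x \<in> extension (ideal_prod R K L)" if "x \<in> ideal_prod B (extension K) (extension L)" for x
    using that
  proof (induction rule: ideal_prod.induct)
    case (prod i j)
    then obtain k s l t where *: "i = fraction k s" "k \<in> K" "s \<in> S" "j = fraction l t" "l \<in> L" "t \<in> S"
      by (meson extensionE)
    then have "i \<otimes>\<^bsub>B\<^esub> j = fraction (k \<otimes> l) (s \<otimes> t)" using K.Icarr L.Icarr by (simp add: fraction_mult)
    moreover have "k \<otimes> l \<in> ideal_prod R K L" using * by (intro ideal_prod.prod)
    ultimately show ?case using extensionI S_mult[OF *(3,6)] by simp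
  next
    case (sum x y)
    then show ?case
      using extension_ideal[OF ideal_prod_is_ideal[OF K L]]
      by (simp add: additive_subgroup.a_closed ideal.axioms(1))
  qed
qed

text \<open>An element of \<open>K\<close> outside \<open>P\<close> is a multiplier that puts every
  numerator into \<open>K\<close>.\<close>

lemma extension_eq_carrier:
  assumes K: "ideal K R" and "\<not> K \<subseteq> P"
  shows "extension K = carrier B"
proof (rule antisym; rule subsetI)
  interpret K: ideal K R by (rule K)
  obtain k where k: "k \<in> K" "k \<in> S" using assms(2) K.Icarr unfolding S_def by auto
  show "x \<in> carrier B" if asm: "x \<in> extension K" for x
    using asm by (auto elim!: extensionE dest: K.Icarr)
  show "x \<in> extension K" if "x \<in> carrier B" for x
    using that fraction_mem_extension_iff[OF K] K.I_r_closed[OF k(1)] k(2)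
    by (auto elim!: B_carrierE)
qed

section \<open>Contraction of ideals from the localization\<close>

definition contraction :: "('a \<times> 'a) set set \<Rightarrow> 'a set" where
  "contraction I = {a \<in> carrier R. fraction a \<one> \<in> I}"

lemma contraction_ideal: "ideal I B \<Longrightarrow> ideal (contraction I) R"
  unfolding contraction_def using ring_hom_ring.ideal_vimage[OF localization_map_hom] .

lemma contraction_primeideal: "primeideal I B \<Longrightarrow> primeideal (contraction I) R"
  unfolding contraction_def using ring_hom_ring.primeideal_vimage[OF localization_map_hom is_cring] .

text \<open>Numerators and denominators can be separated because \<open>s / 1\<close> is a unit. As
  every ideal of \<open>B\<close> is thus extended from \<open>R\<close>, a factorization of its
  contraction yields one in \<open>B\<close>.\<close>

lemma extension_contraction:
  assumes I: "ideal I B"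
  shows "extension (contraction I) = I"
proof (rule antisym; rule subsetI)
  interpret I: ideal I B by (rule I)
  show "x \<in> I" if asm: "x \<in> extension (contraction I)" for x
  proof -
    obtain a s where "x = fraction a s" "a \<in> contraction I" "s \<in> S"
      using asm by (rule extensionE)
    then have x: "x = fraction a s" "a \<in> carrier R" "fraction a \<one> \<in> I" "s \<in> S"
      by (simp_all add: contraction_def)
    have "x = fraction a \<one> \<otimes>\<^bsub>B\<^esub> fraction \<one> s" using x by (simp add: fraction_mult)
    then show ?thesis using x I.I_r_closed by simp
  qed
  show "x \<in> extension (contraction I)" if asm: "x \<in> I" for x
  proof -
    obtain a s where x: "x = fraction a s" "a \<in> carrier R" "s \<in> S"
      using I.Icarr[OF asm] by (rule B_carrierE)
    have "fraction a \<one> = x \<otimes>\<^bsub>B\<^esub> fraction s \<one>"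
      using x by (simp add: fraction_mult) (rule fraction_eqI; simp add: m_ac)
    then have "fraction a \<one> \<in> I" using that x I.I_r_closed by simp
    then show ?thesis using x extensionI by (simp add: contraction_def)
  qed
qed

lemma contraction_subset:
  assumes I: "ideal I B" "I \<noteq> carrier B"
  shows "contraction I \<subseteq> P"
  using extension_eq_carrier[OF contraction_ideal[OF I(1)]] extension_contraction[OF I(1)] I(2)
  by metis

lemma extension_P_primeideal: "primeideal (extension P) B"
proof (rule primeidealI[OF extension_ideal[OF is_ideal] B_cring])
  have mem: "fraction a s \<in> extension P \<longleftrightarrow> a \<in> P" if "a \<in> carrier R" "s \<in> S" for a s
    using fraction_mem_extension_iff[OF is_ideal that] I_prime I_l_closed that by (metis DiffD1 DiffD2 S_def S_one)
  show "carrier B \<noteq> extension P"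
    using mem[of \<one> \<one>] S_one by (metis DiffD2 S_def fraction_closed one_closed)
  fix x y assume "x \<in> carrier B" "y \<in> carrier B" and xy: "x \<otimes>\<^bsub>B\<^esub> y \<in> extension P"
  then obtain a s b t where *: "x = fraction a s" "a \<in> carrier R" "s \<in> S"
    "y = fraction b t" "b \<in> carrier R" "t \<in> S" by (meson B_carrierE)
  then show "x \<in> extension P \<or> y \<in> extension P"
    using xy mem I_prime by (simp add: fraction_mult)
qed

section \<open>Localization at a minimal prime\<close>

lemma extension_radical_ideal:
  assumes minimal: "\<And>Q. primeideal Q R \<Longrightarrow> Q \<subseteq> P \<Longrightarrow> Q = P"
    and H: "proper_radical_ideal R H" "H \<subseteq> P"
  shows "extension H = extension P"
proof (rule antisym)
  have Hi: "ideal H R" using H(1) by (simp add: proper_radical_ideal_def proper_ideal_def)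
  interpret H: ideal H R by (rule Hi)
  show "extension H \<subseteq> extension P" using H(2) by (auto elim!: extensionE intro: extensionI)
  show "extension P \<subseteq> extension H"
  proof
    fix x assume "x \<in> extension P"
    then obtain y r where y: "x = fraction y r" "y \<in> P" "r \<in> S" by (rule extensionE)
    obtain s and n :: nat where s: "s \<in> S" "s \<otimes> y [^] n \<in> {\<zero>}"
      unfolding S_def by (rule power_mem_of_isolated_prime[OF zeroideal primeideal minimal y(2)])
    have yc: "y \<in> carrier R" using y Icarr by blast
    \<comment> \<open>The exponent \<open>Suc n\<close> is positive, as \<open>radical_of\<close>
      demands, and gives \<open>s\<close> enough powers to split off the vanishing product
      \<open>s \<otimes> y [^] n\<close>.\<close>
    have "(s \<otimes> y) [^] Suc n = (s [^] n \<otimes> y) \<otimes> (s \<otimes> y [^] n)"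
      using s(1) yc by (simp add: nat_pow_distrib m_ac)
    also have "\<dots> = \<zero>" using s yc by simp
    finally have "(s \<otimes> y) [^] Suc n \<in> H" by (metis H.zero_closed)
    moreover have "s \<otimes> y \<in> carrier R" using s yc by simp
    ultimately have "s \<otimes> y \<in> radical_of R H" unfolding radical_of_def by blast
    then have "s \<otimes> y \<in> H" using H(1) by (simp add: proper_radical_ideal_def)
    then show "x \<in> extension H"
      using fraction_mem_extension_iff[OF Hi yc y(3)] s(1) y(1) by blast
  qed
qed

text \<open>A prime of \<open>B\<close> contracts to a prime inside \<open>P\<close>, hence to
  \<open>P\<close>, so \<open>extension P\<close> is the only one. In a factorization of
  \<open>contraction I\<close> the invertible factor extends to \<open>B\<close>, and each radical
  factor to \<open>B\<close> or to \<open>extension P\<close>.\<close>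

lemma special_primary_localization:
  assumes isp: "strongly_ISP_ring R"
    and minimal: "\<And>Q. primeideal Q R \<Longrightarrow> Q \<subseteq> P \<Longrightarrow> Q = P"
  shows "special_primary_ring B"
  unfolding special_primary_ring_def
proof (intro exI[of _ "extension P"] conjI allI impI)
  let ?M = "extension P"
  show "{Q. primeideal Q B} = {?M}"
  proof -
    have "Q = ?M" if Q: "primeideal Q B" for Q
    proof -
      have Qi: "ideal Q B" "Q \<noteq> carrier B"
        using Q primeideal.axioms(1) primeideal.I_notcarr by blast+
      have "contraction Q = P"
        using minimal contraction_primeideal[OF Q] contraction_subset[OF Qi] by blast
      then show ?thesis using extension_contraction[OF Qi(1)] by simp
    qed
    then show ?thesis using extension_P_primeideal by blast
  qed
  fix I assume "proper_ideal B I"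
  then have I: "ideal I B" "I \<noteq> carrier B" unfolding proper_ideal_def by blast+
  have "proper_ideal R (contraction I)"
    using contraction_ideal[OF I(1)] contraction_subset[OF I] S_one
    unfolding proper_ideal_def S_def by blast
  then obtain J Hs where J: "invertible_ideal R J" and Hs: "\<forall>H\<in>set Hs. proper_radical_ideal R H"
    and eq: "contraction I = foldl (ideal_prod R) J Hs"
    using isp unfolding strongly_ISP_ring_def by blast
  have Ji: "ideal J R" using J unfolding invertible_ideal_def by blast
  have J1: "extension J = carrier B"
    using extension_eq_carrier[OF Ji] invertible_ideal_not_subset_minimal_prime[OF J primeideal]
      minimal by blast
  \<comment> \<open>The exponent counts the radical factors inside \<open>P\<close>. That the
    partial products are ideals is carried along for \<open>extension_ideal_prod\<close>.\<close>
  have "ideal (foldl (ideal_prod R) J Hs) R \<and>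
      (\<exists>n::nat. extension (foldl (ideal_prod R) J Hs) = ?M [^]\<^bsub>ideals_set B\<^esub> n)"
    using Hs
  proof (induction Hs rule: rev_induct)
    case Nil
    have "\<exists>n::nat. carrier B = ?M [^]\<^bsub>ideals_set B\<^esub> n"
      by (rule exI[of _ 0]) (simp add: ideals_set_def)
    then show ?case using Ji J1 by simp
  next
    case (snoc H Hs)
    let ?K = "foldl (ideal_prod R) J Hs"
    from snoc obtain n :: nat where K: "ideal ?K R" and n: "extension ?K = ?M [^]\<^bsub>ideals_set B\<^esub> n"
      by auto
    have H: "proper_radical_ideal R H" "ideal H R"
      using snoc.prems by (simp_all add: proper_radical_ideal_def proper_ideal_def)
    have prod: "extension (ideal_prod R ?K H) = ideal_prod B (extension ?K) (extension H)"
      by (rule extension_ideal_prod[OF K H(2)])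
    have "\<exists>m::nat. extension (ideal_prod R ?K H) = ?M [^]\<^bsub>ideals_set B\<^esub> m"
    proof (cases "H \<subseteq> P")
      case True
      then have "extension (ideal_prod R ?K H) = ?M [^]\<^bsub>ideals_set B\<^esub> (Suc n)"
        using extension_radical_ideal[OF minimal H(1)] prod n by (simp add: ideals_set_def)
      then show ?thesis by blast
    next
      case False
      then show ?thesis
        using extension_eq_carrier[OF H(2)] prod n B.ideal_prod_one[OF extension_ideal[OF K]] by auto
    qed
    then show ?case using ideal_prod_is_ideal[OF K H(2)] by simp
  qed
  then show "\<exists>n::nat. I = ?M [^]\<^bsub>ideals_set B\<^esub> n"
    using eq extension_contraction[OF I(1)] by metis
qed

section \<open>Localization of a domain at a nonzero prime\<close>

lemma power_locally_multiple:
  assumes dim: "\<And>Q. primeideal Q R \<Longrightarrow> Q \<noteq> {\<zero>} \<Longrightarrow> maximalideal Q R"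
    and a: "a \<in> carrier R" "a \<noteq> \<zero>" and y: "y \<in> P"
  obtains s c and n :: nat where "s \<in> S" "c \<in> carrier R" "s \<otimes> y [^] n = c \<otimes> a"
proof -
  \<comment> \<open>A prime containing \<open>a\<close> is nonzero, hence maximal; so
    \<open>P\<close> is isolated over the principal ideal of \<open>a\<close>.\<close>
  have "Q = P" if Q: "primeideal Q R" "PIdl a \<subseteq> Q" "Q \<subseteq> P" for Q
  proof -
    have "a \<in> Q" using Q(2) cgenideal_self[OF a(1)] by auto
    then have "maximalideal Q R" using dim[OF Q(1)] a(2) by auto
    then show ?thesis
      using maximalideal.I_maximal[of Q R P] is_ideal Q(3) I_notcarr a_subset by auto
  qed
  then obtain s and n :: nat where s: "s \<in> carrier R - P" "s \<otimes> y [^] n \<in> PIdl a"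
    using power_mem_of_isolated_prime[OF cgenideal_ideal[OF a(1)] primeideal _ y] by metis
  then obtain c where "c \<in> carrier R" "s \<otimes> y [^] n = c \<otimes> a"
    unfolding cgenideal_def by auto
  then show ?thesis using that s(1) unfolding S_def by simp
qed

text \<open>Localized at \<open>P\<close>, the ideal \<open>x A\<close> becomes \<open>K P\<close>. If \<open>k p\<close> with \<open>k \<in> K\<close>, \<open>p \<in> P\<close> is \<open>x\<close> up
  to a unit, then \<open>k P \<subseteq> k p A\<^sub>P\<close>, and \<open>k\<close> cancels.\<close>

lemma locally_principal:
  assumes dom: "domain R" and isp: "strongly_ISP_ring R" and P_nonzero: "P \<noteq> {\<zero>}"
    and dim: "\<And>Q. primeideal Q R \<Longrightarrow> Q \<noteq> {\<zero>} \<Longrightarrow> maximalideal Q R"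
  obtains t where "t \<in> P" "t \<noteq> \<zero>"
    "\<And>p. p \<in> P \<Longrightarrow> \<exists>s\<in>S. \<exists>b\<in>carrier R. s \<otimes> p = b \<otimes> t"
proof -
  interpret D: "domain" R by (rule dom)
  obtain x where x: "x \<in> P" "x \<noteq> \<zero>" using P_nonzero zero_closed by auto
  have xc: "x \<in> carrier R" using x(1) by (rule Icarr)
  have X: "ideal (PIdl x) R" by (rule cgenideal_ideal[OF xc])
  \<comment> \<open>Passing to the localization and back removes the influence of the other primes
    over \<open>x\<close>; a power of every element of \<open>P\<close> now lies in
    \<open>I\<close>.\<close>
  define I where "I = contraction (extension (PIdl x))"
  have mem_X: "z \<in> PIdl x \<longleftrightarrow> (\<exists>r\<in>carrier R. z = r \<otimes> x)" for z
    by (auto simp: cgenideal_def)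
  have mem_I: "a \<in> I \<longleftrightarrow> a \<in> carrier R \<and> (\<exists>s\<in>S. \<exists>r\<in>carrier R. s \<otimes> a = r \<otimes> x)" for a
    unfolding I_def contraction_def
    by (simp add: fraction_mem_extension_iff[OF X _ S_one] mem_X cong: conj_cong)
  have I: "ideal I R" unfolding I_def by (intro contraction_ideal extension_ideal X)
  have "\<one> \<notin> I"
  proof
    assume "\<one> \<in> I"
    then obtain s r where s: "s \<in> S" "r \<in> carrier R" "s \<otimes> \<one> = r \<otimes> x" unfolding mem_I by auto
    then have "s \<in> P" using I_l_closed[OF x(1) s(2)] by simp
    then show False using s(1) unfolding S_def by simp
  qed
  then have "proper_ideal R I" using I unfolding proper_ideal_def by auto
  then obtain J Hs where J: "invertible_ideal R J" and ne: "Hs \<noteq> []"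
    and Hs: "\<forall>H\<in>set Hs. proper_radical_ideal R H" and eq: "I = foldl (ideal_prod R) J Hs"
    using isp unfolding strongly_ISP_ring_def by blast
  \<comment> \<open>One radical factor is split off as \<open>H\<close>; the invertible factor and
    the remaining radical ones are collected in \<open>K\<close>.\<close>
  define K where "K = foldl (ideal_prod R) J (butlast Hs)"
  define H where "H = last Hs"
  have "Hs = butlast Hs @ [H]" using ne by (simp add: H_def)
  then have KH: "I = ideal_prod R K H" unfolding eq K_def by (metis foldl_Cons foldl_Nil foldl_append)
  have H: "ideal H R" "H \<noteq> carrier R" "radical_of R H = H"
    using Hs last_in_set[OF ne] by (auto simp: H_def proper_radical_ideal_def proper_ideal_def)
  have K: "ideal K R"
    unfolding K_def
  proof (rule foldl_ideal_prod_is_ideal)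
    show "ideal J R" using J by (simp add: invertible_ideal_def)
    show "ideal H R" if "H \<in> set (butlast Hs)" for H
      using Hs in_set_butlastD[OF that] by (simp add: proper_radical_ideal_def proper_ideal_def)
  qed
  interpret K: ideal K R by (rule K)
  have "P \<subseteq> H"
  proof (rule subsetI)
    fix y assume y: "y \<in> P"
    have yc: "y \<in> carrier R" using y by (rule Icarr)
    obtain s c and n :: nat where s: "s \<in> S" "c \<in> carrier R" "s \<otimes> y [^] n = c \<otimes> x"
      by (rule power_locally_multiple[OF dim xc x(2) y])
    \<comment> \<open>The exponent is raised by one to be positive, as \<open>radical_of\<close>
      requires.\<close>
    have "s \<otimes> y [^] Suc n = (s \<otimes> y [^] n) \<otimes> y" using s(1) yc by (simp add: m_assoc)
    also have "\<dots> = (c \<otimes> y) \<otimes> x" unfolding s(3) using s(2) yc xc by (simp add: m_ac)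
    finally have "s \<otimes> y [^] Suc n = (c \<otimes> y) \<otimes> x" .
    then have "y [^] Suc n \<in> I"
      unfolding mem_I using s(1,2) yc
      by (intro conjI bexI[of _ s] bexI[of _ "c \<otimes> y"]) simp_all
    then have "y [^] Suc n \<in> H" using ideal_prod_inter[OF K H(1)] unfolding KH by auto
    then have "y \<in> radical_of R H" using yc unfolding radical_of_def by blast
    then show "y \<in> H" using H(3) by simp
  qed
  then have "H = P"
    using maximalideal.I_maximal[OF dim[OF primeideal P_nonzero] H(1)] H(2)
      additive_subgroup.a_subset[OF ideal.axioms(1)[OF H(1)]] by auto
  \<comment> \<open>\<open>N\<close> is the contraction of the ideal \<open>x P B\<close>. An
    element of \<open>I\<close> outside \<open>N\<close> is locally \<open>x\<close> times a
    unit.\<close>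
  define N where "N = {z \<in> carrier R. \<exists>s\<in>S. \<exists>q\<in>P. s \<otimes> z = q \<otimes> x}"
  have N_add: "z \<oplus> z' \<in> N" if zz: "z \<in> N" "z' \<in> N" for z z'
  proof -
    obtain s q s' q' where *: "z \<in> carrier R" "s \<in> S" "q \<in> P" "s \<otimes> z = q \<otimes> x"
      "z' \<in> carrier R" "s' \<in> S" "q' \<in> P" "s' \<otimes> z' = q' \<otimes> x"
      using zz unfolding N_def by auto
    have "(s \<otimes> s') \<otimes> (z \<oplus> z') = s' \<otimes> (s \<otimes> z) \<oplus> s \<otimes> (s' \<otimes> z')"
      using *(1,2,3,5,6,7) by (simp add: r_distr m_ac)
    also have "\<dots> = (s' \<otimes> q \<oplus> s \<otimes> q') \<otimes> x"
      unfolding *(4,8) using *(1,2,3,5,6,7) xc by (simp add: l_distr r_distr m_ac)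
    finally have "(s \<otimes> s') \<otimes> (z \<oplus> z') = (s' \<otimes> q \<oplus> s \<otimes> q') \<otimes> x" .
    moreover have "s' \<otimes> q \<oplus> s \<otimes> q' \<in> P" using * I_l_closed a_closed by simp
    ultimately show ?thesis
      unfolding N_def using * S_mult[OF *(2,6)] by (intro CollectI conjI bexI[of _ "s \<otimes> s'"] bexI[of _ "s' \<otimes> q \<oplus> s \<otimes> q'"]) simp_all
  qed
  \<comment> \<open>Otherwise \<open>N\<close>, being closed under sums, would contain all of
    \<open>I = K P\<close> and so \<open>x\<close>. Cancelling \<open>x\<close> would then identify
    an element outside \<open>P\<close> with one of \<open>P\<close>.\<close>
  have "\<exists>k\<in>K. \<exists>p\<in>P. k \<otimes> p \<notin> N"
  proof (rule ccontr)
    assume no: "\<not> ?thesis"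
    have "z \<in> N" if "z \<in> ideal_prod R K P" for z
      using that no N_add by (induction rule: ideal_prod.induct) auto
    moreover have "x \<in> I" unfolding mem_I using xc S_one by (intro conjI bexI[of _ "\<one>"]) simp_all
    ultimately have "x \<in> N" unfolding KH \<open>H = P\<close> by simp
    then obtain s q where s: "s \<in> S" "q \<in> P" "s \<otimes> x = q \<otimes> x" unfolding N_def by auto
    then have "s = q" using D.m_rcancel[OF x(2) xc] by simp
    then show False using s unfolding S_def by simp
  qed
  then obtain k t where k: "k \<in> K" and t: "t \<in> P" and N: "k \<otimes> t \<notin> N" by auto
  have kt: "k \<in> carrier R" "t \<in> carrier R" using k t by simp_all
  have "k \<otimes> t \<in> I" unfolding KH \<open>H = P\<close> using k t by (rule ideal_prod.prod)
  then obtain u r where u: "u \<in> S" "r \<in> carrier R" "u \<otimes> (k \<otimes> t) = r \<otimes> x" unfolding mem_I by auto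
  \<comment> \<open>If \<open>r\<close> were in \<open>P\<close>, the equation just obtained would
    put \<open>k \<otimes> t\<close> into \<open>N\<close>.\<close>
  then have "r \<in> S" using N kt unfolding N_def S_def by auto
  have "\<zero> \<in> N" unfolding N_def using S_one xc by (intro CollectI conjI bexI[of _ \<one>] bexI[of _ \<zero>]) simp_all
  then have nz: "k \<noteq> \<zero>" "t \<noteq> \<zero>" using N kt by auto
  have "\<exists>s\<in>S. \<exists>b\<in>carrier R. s \<otimes> p = b \<otimes> t" if p: "p \<in> P" for p
  proof -
    have pc: "p \<in> carrier R" using p by (rule Icarr)
    have "k \<otimes> p \<in> I" unfolding KH \<open>H = P\<close> using k p by (rule ideal_prod.prod)
    then obtain v b where v: "v \<in> S" "b \<in> carrier R" "v \<otimes> (k \<otimes> p) = b \<otimes> x" unfolding mem_I by auto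
    \<comment> \<open>Both \<open>k \<otimes> p\<close> and \<open>k \<otimes> t\<close> are local
      multiples of \<open>x\<close>, the latter by the local unit \<open>r\<close>. Eliminating
      \<open>x\<close> and cancelling \<open>k\<close> makes \<open>p\<close> a local multiple of
      \<open>t\<close>.\<close>
    have "k \<otimes> ((v \<otimes> r) \<otimes> p) = r \<otimes> (v \<otimes> (k \<otimes> p))" using u(1,2) v(1,2) kt pc by (simp add: m_ac)
    also have "\<dots> = b \<otimes> (u \<otimes> (k \<otimes> t))" unfolding u(3) v(3) using u(1,2) v(1,2) xc by (simp add: m_ac)
    also have "\<dots> = k \<otimes> ((u \<otimes> b) \<otimes> t)" using u(1,2) v(1,2) kt by (simp add: m_ac)
    finally have "(v \<otimes> r) \<otimes> p = (u \<otimes> b) \<otimes> t"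
      using D.m_lcancel[OF nz(1) kt(1)] u(1,2) v(1,2) kt pc by simp
    moreover have "v \<otimes> r \<in> S" by (rule S_mult[OF v(1) \<open>r \<in> S\<close>])
    moreover have "u \<otimes> b \<in> carrier R" using u(1,2) v(1,2) by simp
    ultimately show ?thesis by (intro bexI)
  qed
  then show ?thesis by (rule that[OF t nz(2)])
qed

text \<open>Induction on \<open>m\<close>. An \<open>a\<close> outside \<open>P\<close> is itself a
  local unit, and \<open>m = 0\<close> forces this case. An \<open>a\<close> in \<open>P\<close> is
  locally \<open>b \<otimes> t\<close>; cancelling one \<open>t\<close> shows that \<open>b\<close>
  locally divides \<open>t [^] m\<close>, and the exponent for \<open>a\<close> is one more than
  that for \<open>b\<close>.\<close>

lemma divisor_of_power:
  assumes dom: "domain R" and t: "t \<in> P" "t \<noteq> \<zero>"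
    and principal: "\<And>p. p \<in> P \<Longrightarrow> \<exists>s\<in>S. \<exists>b\<in>carrier R. s \<otimes> p = b \<otimes> t"
    and a: "a \<in> carrier R" "c \<in> carrier R" "s \<in> S" "s \<otimes> t [^] (m::nat) = c \<otimes> a"
  shows "\<exists>s\<in>S. \<exists>u\<in>S. \<exists>n::nat. s \<otimes> a = u \<otimes> t [^] n"
proof -
  interpret D: "domain" R by (rule dom)
  have tc: "t \<in> carrier R" using t(1) by (rule Icarr)
  have notin: "\<exists>s\<in>S. \<exists>u\<in>S. \<exists>n::nat. s \<otimes> a = u \<otimes> t [^] n" if "a \<in> carrier R" "a \<notin> P" for a
    using that S_one by (intro bexI[of _ \<one>] bexI[of _ a] exI[of _ 0]) (simp_all add: S_def)
  show ?thesis
    using a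
  proof (induction m arbitrary: a s)
    case 0
    have "a \<notin> P"
    proof
      assume "a \<in> P"
      then have "s \<in> P" using I_l_closed[of a c] 0 by simp
      then show False using 0(3) unfolding S_def by simp
    qed
    then show ?case using notin 0 by simp
  next
    case (Suc m)
    show ?case
    proof (cases "a \<in> P")
      case False
      then show ?thesis using notin Suc.prems(1) by simp
    next
      case True
      obtain s1 b where b: "s1 \<in> S" "b \<in> carrier R" "s1 \<otimes> a = b \<otimes> t"
        using principal[OF True] by (elim bexE)
      have "t \<otimes> ((s1 \<otimes> s) \<otimes> t [^] m) = s1 \<otimes> (s \<otimes> t [^] Suc m)"
        using b(1,2) Suc.prems(1-3) tc by (simp add: m_ac)
      also have "\<dots> = c \<otimes> (s1 \<otimes> a)" unfolding Suc.prems(4) using b(1,2) Suc.prems(1-3) by (simp add: m_ac)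
      also have "\<dots> = t \<otimes> (c \<otimes> b)" unfolding b(3) using b(1,2) Suc.prems(1-3) tc by (simp add: m_ac)
      finally have "(s1 \<otimes> s) \<otimes> t [^] m = c \<otimes> b"
        using D.m_lcancel[OF t(2) tc] b(1,2) Suc.prems(1-3) tc by simp
      then obtain s2 u and n :: nat where u: "s2 \<in> S" "u \<in> S" "s2 \<otimes> b = u \<otimes> t [^] n"
        using Suc.IH[OF b(2) Suc.prems(2) S_mult[OF b(1) Suc.prems(3)]] by auto
      have "(s2 \<otimes> s1) \<otimes> a = s2 \<otimes> (s1 \<otimes> a)" using u(1,2) b(1,2) Suc.prems(1-3) by (simp add: m_assoc)
      also have "\<dots> = (s2 \<otimes> b) \<otimes> t" unfolding b(3) using u(1,2) b(1,2) tc by (simp add: m_assoc)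
      also have "\<dots> = u \<otimes> t [^] Suc n" unfolding u(3) using u(1,2) tc by (simp add: m_assoc)
      finally show ?thesis
        using S_mult[OF u(1) b(1)] u(2) by (intro bexI exI)
    qed
  qed
qed

lemma fraction_eq_zero_iff:
  assumes "domain R" "a \<in> carrier R" "s \<in> S"
  shows "fraction a s = \<zero>\<^bsub>B\<^esub> \<longleftrightarrow> a = \<zero>"
proof -
  interpret D: "domain" R by fact
  have "\<zero> \<notin> S" unfolding S_def by simp
  have "fraction a s = \<zero>\<^bsub>B\<^esub> \<longleftrightarrow> (\<exists>u\<in>S. u \<otimes> (a \<otimes> \<one>) = u \<otimes> (\<zero> \<otimes> s))"
    unfolding B_zero using assms by (intro fraction_eq_iff) simp_all
  also have "\<dots> \<longleftrightarrow> (\<exists>u\<in>S. u = \<zero> \<or> a = \<zero>)"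
    using assms by (intro bex_cong refl) (simp add: D.integral_iff)
  also have "\<dots> \<longleftrightarrow> a = \<zero>" using \<open>\<zero> \<notin> S\<close> by (metis S_one)
  finally show ?thesis .
qed

lemma domain_localization:
  assumes dom: "domain R"
  shows "domain B"
proof (rule domainI[OF B_cring])
  interpret D: "domain" R by (rule dom)
  show "\<one>\<^bsub>B\<^esub> \<noteq> \<zero>\<^bsub>B\<^esub>"
    unfolding B_one using fraction_eq_zero_iff[OF dom one_closed S_one] by simp
  fix x y assume xy: "x \<otimes>\<^bsub>B\<^esub> y = \<zero>\<^bsub>B\<^esub>" and x: "x \<in> carrier B" and y: "y \<in> carrier B"
  obtain a s where a: "x = fraction a s" "a \<in> carrier R" "s \<in> S" using x by (rule B_carrierE)
  obtain b r where b: "y = fraction b r" "b \<in> carrier R" "r \<in> S" using y by (rule B_carrierE)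
  have "fraction (a \<otimes> b) (s \<otimes> r) = \<zero>\<^bsub>B\<^esub>" using xy a b by (simp add: fraction_mult)
  then have "a \<otimes> b = \<zero>" using fraction_eq_zero_iff[OF dom] a b by simp
  then show "x = \<zero>\<^bsub>B\<^esub> \<or> y = \<zero>\<^bsub>B\<^esub>"
    using fraction_eq_zero_iff[OF dom] a b D.integral_iff by simp
qed

text \<open>The local generator \<open>t\<close> of \<open>P\<close> becomes the uniformizer: each
  nonzero numerator locally divides a power of \<open>t\<close>, hence is a local unit times a power
  of \<open>t\<close>.\<close>

lemma discrete_valuation_localization:
  assumes dom: "domain R" and isp: "strongly_ISP_ring R" and P_nonzero: "P \<noteq> {\<zero>}"
    and dim: "\<And>Q. primeideal Q R \<Longrightarrow> Q \<noteq> {\<zero>} \<Longrightarrow> maximalideal Q R"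
  shows "discrete_rank_one_valuation_domain B"
proof -
  obtain t where t: "t \<in> P" "t \<noteq> \<zero>"
    and principal: "\<And>p. p \<in> P \<Longrightarrow> \<exists>s\<in>S. \<exists>b\<in>carrier R. s \<otimes> p = b \<otimes> t"
    using locally_principal[OF assms] by metis
  have tc: "t \<in> carrier R" using t(1) by (rule Icarr)
  let ?t = "fraction t \<one>"
  have pow: "fraction (t [^] n) \<one> = ?t [^]\<^bsub>B\<^esub> n" for n :: nat
    using ring_hom_ring.hom_nat_pow[OF localization_map_hom tc] .
  have "uniformized_domain B ?t"
  proof (intro uniformized_domain.intro uniformized_domain_axioms.intro domain_localization dom)
    show "?t \<in> carrier B" using tc by simp
    show "?t \<noteq> \<zero>\<^bsub>B\<^esub>" using fraction_eq_zero_iff[OF dom tc S_one] t(2) by simp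
    show "?t \<notin> Units B"
    proof
      assume "?t \<in> Units B"
      then obtain y where y: "y \<in> carrier B" "?t \<otimes>\<^bsub>B\<^esub> y = \<one>\<^bsub>B\<^esub>" unfolding Units_def by auto
      interpret M: primeideal "extension P" B by (rule extension_P_primeideal)
      have "\<one>\<^bsub>B\<^esub> \<in> extension P"
        using M.I_r_closed[OF extensionI[OF t(1) S_one] y(1)] y(2) by simp
      then show False using M.one_imp_carrier M.I_notcarr by simp
    qed
  next
    fix z assume z: "z \<in> carrier B" "z \<noteq> \<zero>\<^bsub>B\<^esub>"
    obtain a r where a: "z = fraction a r" "a \<in> carrier R" "r \<in> S" using z(1) by (rule B_carrierE)
    have "a \<noteq> \<zero>" using z(2) a fraction_eq_zero_iff[OF dom] by simp
    obtain s c and m :: nat where "s \<in> S" "c \<in> carrier R" "s \<otimes> t [^] m = c \<otimes> a"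
      by (rule power_locally_multiple[OF dim a(2) \<open>a \<noteq> \<zero>\<close> t(1)])
    then obtain s u and n :: nat where u: "s \<in> S" "u \<in> S" "s \<otimes> a = u \<otimes> t [^] n"
      using divisor_of_power[OF dom t principal a(2)] by metis
    \<comment> \<open>The multiplier \<open>s\<close> and the denominator \<open>r\<close> both lie
      outside \<open>P\<close> and are absorbed into the unit.\<close>
    have "z = fraction u (s \<otimes> r) \<otimes>\<^bsub>B\<^esub> fraction (t [^] n) \<one>"
    proof -
      have "a \<otimes> (s \<otimes> r) = (s \<otimes> a) \<otimes> r" using a(2,3) u(1) by (simp add: m_ac)
      then have "fraction a r = fraction (u \<otimes> t [^] n) (s \<otimes> r)"
        unfolding u(3) using a(2,3) u(1,2) tc by (intro fraction_eqI) simp_all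
      then show ?thesis using a u(1,2) tc by (simp add: fraction_mult)
    qed
    then have "z = fraction u (s \<otimes> r) \<otimes>\<^bsub>B\<^esub> ?t [^]\<^bsub>B\<^esub> n" unfolding pow .
    moreover have "fraction u (s \<otimes> r) \<in> Units B" by (rule fraction_unit[OF u(2) S_mult[OF u(1) a(3)]])
    ultimately show "\<exists>u\<in>Units B. \<exists>n::nat. z = u \<otimes>\<^bsub>B\<^esub> ?t [^]\<^bsub>B\<^esub> n" by (intro bexI exI)
  qed
  then show ?thesis by (rule uniformized_domain.discrete_rank_one_valuation)
qed

end

theorem theorem4p7:
  fixes A :: "('a, 'm) ring_scheme" (structure)
  assumes "cring A" and "\<one> \<noteq> \<zero>"
    and "strongly_ISP_ring A"
    and "\<And>P. primeideal P A \<Longrightarrow> P \<noteq> {\<zero>} \<Longrightarrow> maximalideal P A"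
  shows "almost_multiplication_ring A"
  unfolding almost_multiplication_ring_def
proof (intro allI impI)
  fix P assume P: "primeideal P A"
  interpret cring A by fact
  interpret prime_localization P A by (rule prime_localization.intro[OF P])
  show "discrete_rank_one_valuation_domain (localization_at_prime A P) \<or>
      special_primary_ring (localization_at_prime A P)"
  \<comment> \<open>The zero ideal is prime exactly when \<open>A\<close> is a domain. In the other
    case \<open>P\<close> is minimal: a nonzero prime inside \<open>P\<close> is maximal and equals
    \<open>P\<close>, while a zero one makes the zero ideal prime and so forces
    \<open>P = {\<zero>}\<close>.\<close>
  proof (cases "primeideal {\<zero>} A \<and> P \<noteq> {\<zero>}")
    case True
    then show ?thesis
      using discrete_valuation_localization assms(3,4) zeroprimeideal_domainI by simp
  next
    case False
    have "Q = P" if Q: "primeideal Q A" "Q \<subseteq> P" for Q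
    proof (cases "Q = {\<zero>}")
      case True
      then show ?thesis using False Q(1) by simp
    next
      case nonzero: False
      then show ?thesis
        using maximalideal.I_maximal[OF assms(4)[OF Q(1)] is_ideal Q(2)] I_notcarr a_subset by auto
    qed
    then show ?thesis using special_primary_localization assms(3) by simp
  qed
qed

end
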